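(* (Derived Category Theorem.) Let $A$ be a finite alphabet, let $(H_1,V_1)$, $(H_2,V_2)$ be finite forest algebras, and let $\alpha:A^{\Delta}\to (H_1,V_1)$ and $\beta:A^{\Delta}\to(H_2,V_2)$ be surjective forest algebra homomorphisms. Let $(H,V)$ be a finite forest algebra. (a) If $\mathcal{D}_{\alpha,\beta}\prec (H,V)$, then $(H_1,V_1)\prec (H,V)\circ (H_2,V_2)$. (b) Suppose $\alpha=\gamma\delta$, where $\delta:A^{\Delta}\to (H,V)\circ(H_2,V_2)$ is a forest algebra homomorphism and $\gamma:\mathrm{Im}\,\delta\to (H_1,V_1)$ is a forest algebra homomorphism, and suppose $\beta=\pi\delta$, where $\pi$ is the projection of the wreath product onto its right-hand factor. Then $\mathcal{D}_{\alpha,\beta}\prec (H,V)$.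
   Context: Forest algebras. A forest algebra $(H,V)$ consists of a commutative monoid $H$ (written additively, identity $0$), a monoid $V$ (written multiplicatively, identity $1$), and a right action $H\times V\to H$, $(h,v)\mapsto hv$, with $(hv_1)v_2=h(v_1v_2)$, $h1=h$, which is faithful ($hv=hv'$ for all $h\in H$ implies $v=v'$), and such that for all $v\in V$, $h\in H$ there is an element $v+h\in V$ with $g(v+h)=gv+h$ for all $g\in H$. A homomorphism $(H,V)\to(H',V')$ is a pair of monoid homomorphisms (both denoted by the same letter) $H\to H'$, $V\to V'$ with $\alpha(hv)=\alpha(h)\alpha(v)$. $(H,V)\prec(H',V')$ ("divides") means $(H,V)$ is a homomorphic image of a subalgebra of $(H',V')$. Free forest algebra. For a finite alphabet $A$, $A^{\Delta}=(H_A,V_A)$: $H_A$ is the set of finite forests (finite multisets of finite rooted trees with unordered children) with nodes labeled by letters of $A$, with $+$ the disjoint union and $0$ the empty forest; $V_A$ is the set of contexts, i.e. such forests in which exactly one leaf is replaced by a hole $\Box$ (the hole alone is the identity context). For $s\in H_A$, $p,q\in V_A$: $sp$ is obtained by substituting $s$ for the hole of $p$, $pq$ by substituting $p$ for the hole of $q$, and $p+s$ by adding the trees of $s$ to $p$. For $a\in A$, $\Box a$ is the context consisting of a root labeled $a$ whose only child is the hole. Every map $f:A\to V$ into a forest algebra $(H,V)$ extends uniquely to a homomorphism with $\Box a\mapsto f(a)$. Wreath product. $(H,V)\circ(H_2,V_2)=(H\times H_2,\,V^{H_2}\times V_2)$ with componentwise addition on $H\times H_2$, action $(h,h_2)(f,v_2)=(h\cdot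 f(h_2),\,h_2v_2)$, and product $(f_1,v_1)(f_2,v_2)=(g,v_1v_2)$ where $g(h_2)=f_1(h_2)f_2(h_2v_1)$; this is a forest algebra and $\pi$ denotes the projection homomorphism onto the right factor $(H_2,V_2)$. Forest categories. A forest category $\mathcal C$ consists of: a finite set $\mathrm{Obj}(\mathcal C)$ which is a commutative monoid under $+$ with identity $0$; for all objects $x,y$ a set $\mathrm{Arr}(x,y)$ of arrows (pairwise disjoint, with union $\mathrm{Arr}(\mathcal C)$); for each object $x$ a set $\mathrm{HArr}(x)$ of half-arrows to $x$ (pairwise disjoint, with union $\mathrm{HArr}(\mathcal C)$), subject to: (1) $\mathrm{HArr}(\mathcal C)$ is a commutative monoid under $+$ with $\mathrm{HArr}(x)+\mathrm{HArr}(y)\subseteq\mathrm{HArr}(x+y)$, the map sending a half-arrow in $\mathrm{HArr}(x)$ to $x$ being a homomorphism onto $\mathrm{Obj}(\mathcal C)$; (2) an associative composition $\mathrm{Arr}(x,y)\times\mathrm{Arr}(y,z)\to\mathrm{Arr}(x,z)$, $(u,v)\mapsto uv$, with identity arrows $1_x\in\mathrm{Arr}(x,x)$; (3) an action $\mathrm{HArr}(x)\times\mathrm{Arr}(x,y)\to\mathrm{HArr}(y)$, $(c,u)\mapsto cu$, with $(cu)v=c(uv)$ and $c1_x=c$, which is faithful: if $u,u'\in\mathrm{Arr}(x,y)$ and $cu=cu'$ for all $c\in\mathrm{HArr}(x)$ then $u=u'$; (4) for $u\in\mathrm{Arr}(x,y)$ and $c\in\mathrm{HArr}(z)$ an arrow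 $u+c\in\mathrm{Arr}(x,y+z)$ with $f(u+c)=(fu)+c$ for all arrows $f\in\mathrm{Arr}(w,x)$ and $(u+c)+d=u+(c+d)$ for all half-arrows $d$. Division of a forest category by a forest algebra. $\mathcal C\prec(H,V)$ means: there are nonempty sets $K_c\subseteq H$ for each half-arrow $c$ and $K_u\subseteq V$ for each arrow $u$ such that, whenever the operations are defined, $K_uK_v\subseteq K_{uv}$, $K_cK_u\subseteq K_{cu}$, $K_c+K_d\subseteq K_{c+d}$, and $K_u+K_c\subseteq K_{u+c}$ (with $u,v$ arrows, $c,d$ half-arrows); and distinct arrows in the same $\mathrm{Arr}(x,y)$ have disjoint covering sets, and distinct half-arrows in the same $\mathrm{HArr}(y)$ have disjoint covering sets. Derived category $\mathcal D_{\alpha,\beta}$. Objects: $H_2$. Half-arrows to $h\in H_2$: pairs $(\alpha(s),h)$ with $s\in H_A$, $\beta(s)=h$, added componentwise. Arrows from $h$ to $h'$: equivalence classes of triples $(h,p,h')$ with $p\in V_A$ and $h\beta(p)=h'$, where $(h,p,h')\sim(h,q,h')$ iff $\alpha(sp)=\alpha(sq)$ for all $s\in H_A$ with $\beta(s)=h$. Operations: $[h,p,h'][h',q,h'']=[h,pq,h'']$; identity $[h,1,h]$; $(h_1,h_2)[h_2,p,h_2']=(h_1\alpha(p),h_2')$; $[h,p,h']+(\alpha(s),\beta(s))=[h,p+s,h'+\beta(s)]$. This is a forest category. *)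

theory Defs
  imports "HOL-Algebra.Group" "HOL-Library.Multiset"
begin

hide_const (open) Multiset.mult

section \<open>Forest algebras\<close>

text \<open>
  The horizontal monoid is commutative and thought of additively; both monoids are nevertheless
  records of HOL-Algebra, so that its notions of monoid, submonoid and homomorphism apply.
\<close>

record ('h, 'v) forest_alg =
  hmon :: "'h monoid"
  vmon :: "'v monoid"
  act :: "'h \<Rightarrow> 'v \<Rightarrow> 'h"

abbreviation H_of :: "('h, 'v, 'm) forest_alg_scheme \<Rightarrow> 'h set" where
  "H_of F \<equiv> carrier (hmon F)"

abbreviation V_of :: "('h, 'v, 'm) forest_alg_scheme \<Rightarrow> 'v set" where
  "V_of F \<equiv> carrier (vmon F)"

abbreviation hadd :: "('h, 'v, 'm) forest_alg_scheme \<Rightarrow> 'h \<Rightarrow> 'h \<Rightarrow> 'h" where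
  "hadd F \<equiv> mult (hmon F)"

abbreviation vmult :: "('h, 'v, 'm) forest_alg_scheme \<Rightarrow> 'v \<Rightarrow> 'v \<Rightarrow> 'v" where
  "vmult F \<equiv> mult (vmon F)"

locale forest_algebra =
  fixes F :: "('h, 'v, 'm) forest_alg_scheme"
  assumes hmon_comm_monoid: "comm_monoid (hmon F)"
    and vmon_monoid: "monoid (vmon F)"
    and act_closed: "h \<in> H_of F \<Longrightarrow> v \<in> V_of F \<Longrightarrow> act F h v \<in> H_of F"
    and act_mult: "h \<in> H_of F \<Longrightarrow> v \<in> V_of F \<Longrightarrow> w \<in> V_of F \<Longrightarrow>
      act F (act F h v) w = act F h (vmult F v w)"
    and act_one: "h \<in> H_of F \<Longrightarrow> act F h \<one>\<^bsub>vmon F\<^esub> = h"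
    and faithful: "v \<in> V_of F \<Longrightarrow> w \<in> V_of F \<Longrightarrow>
      (\<And>h. h \<in> H_of F \<Longrightarrow> act F h v = act F h w) \<Longrightarrow> v = w"
    and vadd_ex: "v \<in> V_of F \<Longrightarrow> h \<in> H_of F \<Longrightarrow>
      \<exists>w \<in> V_of F. \<forall>g \<in> H_of F. act F g w = hadd F (act F g v) h"

locale finite_forest_algebra = forest_algebra +
  assumes finite_H: "finite (H_of F)"
    and finite_V: "finite (V_of F)"

text \<open>The element \<open>v + h\<close>; it is unique by faithfulness.\<close>

definition vadd :: "('h, 'v, 'm) forest_alg_scheme \<Rightarrow> 'v \<Rightarrow> 'h \<Rightarrow> 'v" where
  "vadd F v h = (THE w. w \<in> V_of F \<and> (\<forall>g \<in> H_of F. act F g w = hadd F (act F g v) h))"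

lemma (in forest_algebra) vadd_unique:
  assumes "v \<in> V_of F" "h \<in> H_of F" "w \<in> V_of F"
    and "\<And>g. g \<in> H_of F \<Longrightarrow> act F g w = hadd F (act F g v) h"
  shows "vadd F v h = w"
  unfolding vadd_def
proof (rule the_equality)
  show "w \<in> V_of F \<and> (\<forall>g\<in>H_of F. act F g w = hadd F (act F g v) h)"
    using assms by blast
next
  fix w' assume "w' \<in> V_of F \<and> (\<forall>g\<in>H_of F. act F g w' = hadd F (act F g v) h)"
  then show "w' = w" using assms by (intro faithful) auto
qed

lemma (in forest_algebra)
  assumes "v \<in> V_of F" "h \<in> H_of F"
  shows vadd_closed: "vadd F v h \<in> V_of F"
    and act_vadd: "g \<in> H_of F \<Longrightarrow> act F g (vadd F v h) = hadd F (act F g v) h"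
  using vadd_ex[OF assms] vadd_unique[OF assms] by auto

text \<open>
  A homomorphism is not asked to preserve \<open>v + h\<close>; a surjective one onto a forest algebra does so
  automatically, by faithfulness of the target.
\<close>

definition monoid_hom :: "('a, 'm) monoid_scheme \<Rightarrow> ('b, 'n) monoid_scheme \<Rightarrow> ('a \<Rightarrow> 'b) \<Rightarrow> bool" where
  "monoid_hom M N f \<longleftrightarrow> f \<in> hom M N \<and> f \<one>\<^bsub>M\<^esub> = \<one>\<^bsub>N\<^esub>"

definition forest_hom ::
  "('h, 'v, 'm) forest_alg_scheme \<Rightarrow> ('k, 'w, 'n) forest_alg_scheme \<Rightarrow>
    ('h \<Rightarrow> 'k) \<Rightarrow> ('v \<Rightarrow> 'w) \<Rightarrow> bool" where
  "forest_hom F G \<phi>H \<phi>V \<longleftrightarrow>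
    monoid_hom (hmon F) (hmon G) \<phi>H \<and> monoid_hom (vmon F) (vmon G) \<phi>V \<and>
    (\<forall>h \<in> H_of F. \<forall>v \<in> V_of F. \<phi>H (act F h v) = act G (\<phi>H h) (\<phi>V v))"

definition forest_surj_hom ::
  "('h, 'v, 'm) forest_alg_scheme \<Rightarrow> ('k, 'w, 'n) forest_alg_scheme \<Rightarrow>
    ('h \<Rightarrow> 'k) \<Rightarrow> ('v \<Rightarrow> 'w) \<Rightarrow> bool" where
  "forest_surj_hom F G \<phi>H \<phi>V \<longleftrightarrow>
    forest_hom F G \<phi>H \<phi>V \<and> \<phi>H ` H_of F = H_of G \<and> \<phi>V ` V_of F = V_of G"

definition restrict_alg ::
  "('h, 'v, 'm) forest_alg_scheme \<Rightarrow> 'h set \<Rightarrow> 'v set \<Rightarrow> ('h, 'v, 'm) forest_alg_scheme" where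
  "restrict_alg F S T = F\<lparr>hmon := (hmon F)\<lparr>carrier := S\<rparr>, vmon := (vmon F)\<lparr>carrier := T\<rparr>\<rparr>"

definition image_alg ::
  "('h, 'v, 'm) forest_alg_scheme \<Rightarrow> ('k, 'w, 'n) forest_alg_scheme \<Rightarrow>
    ('h \<Rightarrow> 'k) \<Rightarrow> ('v \<Rightarrow> 'w) \<Rightarrow> ('k, 'w, 'n) forest_alg_scheme" where
  "image_alg F G \<phi>H \<phi>V = restrict_alg G (\<phi>H ` H_of F) (\<phi>V ` V_of F)"

text \<open>
  A subalgebra is a pair of subsets closed under all operations (including \<open>v + h\<close>) and containing
  both identities.  Distinct elements of \<open>T\<close> may agree on the smaller set \<open>S\<close>: faithfulness is not
  an operation and is not inherited, and image algebras such as \<open>image_alg\<close> need not have it.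
\<close>

definition subalgebra :: "'h set \<Rightarrow> 'v set \<Rightarrow> ('h, 'v, 'm) forest_alg_scheme \<Rightarrow> bool" where
  "subalgebra S T F \<longleftrightarrow>
    submonoid S (hmon F) \<and> submonoid T (vmon F) \<and>
    (\<forall>h \<in> S. \<forall>v \<in> T. act F h v \<in> S) \<and> (\<forall>v \<in> T. \<forall>h \<in> S. vadd F v h \<in> T)"

definition alg_divides ::
  "('h, 'v, 'm) forest_alg_scheme \<Rightarrow> ('k, 'w, 'n) forest_alg_scheme \<Rightarrow> bool" where
  "alg_divides F G \<longleftrightarrow>
    (\<exists>S T \<phi>H \<phi>V. subalgebra S T G \<and> forest_surj_hom (restrict_alg G S T) F \<phi>H \<phi>V)"


section \<open>The free forest algebra\<close>

datatype (labels: 'a) tree = Node 'a "'a tree multiset"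

type_synonym 'a forest = "'a tree multiset"

text \<open>
  A context is a forest with exactly one hole at a leaf.  Exactly one of its top-level components
  contains the hole: this component is either the hole itself (\<open>Hole s\<close> is \<open>\<box> + s\<close>) or a tree whose
  root is labelled \<open>a\<close> and whose children form a context \<open>p\<close> (\<open>Under a p s\<close> is \<open>pa + s\<close>).
\<close>

datatype (ctx_labels: 'a) ctx = Hole "'a forest" | Under 'a "'a ctx" "'a forest"

primrec plug :: "'a forest \<Rightarrow> 'a ctx \<Rightarrow> 'a forest" where
  "plug s (Hole t) = s + t"
| "plug s (Under a p t) = {#Node a (plug s p)#} + t"

primrec ctx_add :: "'a ctx \<Rightarrow> 'a forest \<Rightarrow> 'a ctx" where
  "ctx_add (Hole t) s = Hole (t + s)"
| "ctx_add (Under a p t) s = Under a p (t + s)"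

primrec ctx_comp :: "'a ctx \<Rightarrow> 'a ctx \<Rightarrow> 'a ctx" where
  "ctx_comp p (Hole t) = ctx_add p t"
| "ctx_comp p (Under a q t) = Under a (ctx_comp p q) t"

definition free_alg :: "'a set \<Rightarrow> ('a forest, 'a ctx) forest_alg" where
  "free_alg A =
    \<lparr>hmon = \<lparr>carrier = {s. \<forall>t \<in># s. labels t \<subseteq> A}, mult = (+), one = {#}\<rparr>,
     vmon = \<lparr>carrier = {p. ctx_labels p \<subseteq> A}, mult = ctx_comp, one = Hole {#}\<rparr>,
     act = plug\<rparr>"

lemma plug_ctx_add: "plug s (ctx_add p t) = plug s p + t"
  by (cases p) (auto simp: ac_simps)

lemma plug_ctx_comp: "plug s (ctx_comp p q) = plug (plug s p) q"
  by (induction q) (auto simp: plug_ctx_add)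

lemma ctx_add_labels: "ctx_labels (ctx_add p t) = ctx_labels p \<union> (\<Union>x \<in> set_mset t. labels x)"
  by (cases p) auto

lemma ctx_comp_labels: "ctx_labels (ctx_comp p q) = ctx_labels p \<union> ctx_labels q"
  by (induction q) (auto simp: ctx_add_labels)

lemma plug_labels:
  "(\<Union>x \<in> set_mset (plug s p). labels x) = (\<Union>x \<in> set_mset s. labels x) \<union> ctx_labels p"
  by (induction p) auto

lemma ctx_add_assoc: "ctx_add (ctx_add p s) t = ctx_add p (s + t)"
  by (cases p) (auto simp: ac_simps)

lemma ctx_add_comp: "ctx_comp p (ctx_add q t) = ctx_add (ctx_comp p q) t"
  by (cases q) (auto simp: ctx_add_assoc)

lemma ctx_comp_assoc: "ctx_comp (ctx_comp p q) r = ctx_comp p (ctx_comp q r)"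
  by (induction r) (auto simp: ctx_add_comp)

lemma ctx_add_empty [simp]: "ctx_add p {#} = p"
  by (cases p) auto

lemma ctx_comp_one [simp]: "ctx_comp (Hole {#}) p = p" "ctx_comp p (Hole {#}) = p"
  by (induction p) auto

lemma free_alg_simps [simp]:
  "s \<in> H_of (free_alg A) \<longleftrightarrow> (\<Union>t \<in> set_mset s. labels t) \<subseteq> A"
  "p \<in> V_of (free_alg A) \<longleftrightarrow> ctx_labels p \<subseteq> A"
  "hadd (free_alg A) = (+)" "vmult (free_alg A) = ctx_comp" "act (free_alg A) = plug"
  "\<one>\<^bsub>hmon (free_alg A)\<^esub> = {#}" "\<one>\<^bsub>vmon (free_alg A)\<^esub> = Hole {#}"
  by (auto simp: free_alg_def)

primrec chain :: "'a \<Rightarrow> nat \<Rightarrow> 'a tree" where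
  "chain a 0 = Node a {#}"
| "chain a (Suc n) = Node a {#chain a n#}"

lemma chain_labels [simp]: "labels (chain a n) = {a}"
  by (induction n) auto

primrec tsize :: "'a tree \<Rightarrow> nat" where
  "tsize (Node a s) = Suc (\<Sum>\<^sub># (image_mset tsize s))"

lemma tsize_chain: "tsize (chain a n) = Suc n"
  by (induction n) auto

lemma tsize_mem: "t \<in># s \<Longrightarrow> tsize t \<le> \<Sum>\<^sub># (image_mset tsize s)"
  by (metis image_mset_add_mset insert_DiffM le_add1 sum_mset.add_mset)

primrec csize :: "'a ctx \<Rightarrow> nat" where
  "csize (Hole s) = \<Sum>\<^sub># (image_mset tsize s)"
| "csize (Under a p s) = csize p + \<Sum>\<^sub># (image_mset tsize s)"

lemma tsize_plug: "tsize t \<le> \<Sum>\<^sub># (image_mset tsize (plug {#t#} p))"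
  by (induction p) auto

lemma plug_chain_inj:
  "csize p < n \<Longrightarrow> csize q < n \<Longrightarrow> plug {#chain a n#} p = plug {#chain a n#} q \<Longrightarrow> p = q"
proof (induction p arbitrary: q)
  case (Hole s)
  show ?case
  proof (cases q)
    case (Hole t) then show ?thesis using Hole.prems by auto
  next
    case (Under b q' t)
    have "Node b (plug {#chain a n#} q') \<in># add_mset (chain a n) s"
      using Hole.prems Under by auto
    moreover have "tsize (Node b (plug {#chain a n#} q')) > tsize (chain a n)"
      using tsize_plug[of "chain a n" q'] by auto
    moreover have "x \<in># s \<Longrightarrow> tsize x < tsize (chain a n)" for x
      using tsize_mem[of x s] Hole.prems by (auto simp: tsize_chain)
    ultimately have False
      by (metis insert_iff set_mset_add_mset_insert less_irrefl less_trans)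
    then show ?thesis ..
  qed
next
  case (Under b p s)
  have big: "tsize (Node c (plug {#chain a n#} r)) > tsize (chain a n)" for c and r
    using tsize_plug[of "chain a n" r] by auto
  show ?case
  proof (cases q)
    case (Hole t)
    have "Node b (plug {#chain a n#} p) \<in># add_mset (chain a n) t"
      using Under.prems Hole by (metis add_mset_add_single plug.simps union_iff
        union_commute add_mset_add_single insert_iff set_mset_add_mset_insert)
    moreover have "x \<in># t \<Longrightarrow> tsize x < tsize (chain a n)" for x
      using tsize_mem[of x t] Under.prems Hole by (auto simp: tsize_chain)
    ultimately have False using big[of b p]
      by (metis insert_iff set_mset_add_mset_insert less_irrefl less_trans)
    then show ?thesis ..
  next
    case (Under c q' t)
    let ?x = "Node b (plug {#chain a n#} p)" and ?y = "Node c (plug {#chain a n#} q')"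
    have eq: "add_mset ?x s = add_mset ?y t" using Under.prems Under by simp
    have "x \<in># t \<Longrightarrow> tsize x < tsize (chain a n)" for x
      using tsize_mem[of x t] Under.prems Under by (auto simp: tsize_chain)
    then have "?x \<notin># t" using big[of b p] by (meson less_irrefl less_trans)
    then have "?x = ?y" using eq by (metis insert_iff set_mset_add_mset_insert)
    then show ?thesis using eq Under.prems Under Under.IH[of q'] by auto
  qed
qed

lemma forest_algebra_free_alg: "forest_algebra (free_alg A)"
proof (rule forest_algebra.intro)
  fix p q :: "'a ctx"
  assume p: "p \<in> V_of (free_alg A)" and q: "q \<in> V_of (free_alg A)"
    and eq: "\<And>h. h \<in> H_of (free_alg A) \<Longrightarrow> act (free_alg A) h p = act (free_alg A) h q"
  show "p = q"
  proof (cases "A = {}")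
    case True
    have *: "r = Hole {#}" if "ctx_labels r = {}" for r :: "'a ctx"
    proof -
      have "labels t \<noteq> {}" for t :: "'a tree" by (cases t) auto
      then show ?thesis using that by (cases r) auto
    qed
    show ?thesis using *[of p] *[of q] p q True by simp
  next
    case False
    then obtain a where "a \<in> A" by blast
    then show ?thesis
      using eq[of "{#chain a (Suc (csize p + csize q))#}"]
      by (intro plug_chain_inj[of p "Suc (csize p + csize q)" q a]) auto
  qed
next
  fix p and s :: "'a forest"
  assume "p \<in> V_of (free_alg A)" "s \<in> H_of (free_alg A)"
  then show "\<exists>w\<in>V_of (free_alg A). \<forall>g\<in>H_of (free_alg A).
      act (free_alg A) g w = hadd (free_alg A) (act (free_alg A) g p) s"
    by (intro bexI[of _ "ctx_add p s"]) (auto simp: plug_ctx_add ctx_add_labels)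
next
  show "monoid (vmon (free_alg A))"
    by (rule monoidI) (auto simp: ctx_comp_labels ctx_comp_assoc)
next
  show "comm_monoid (hmon (free_alg A))"
    by (rule comm_monoidI) (auto simp: ac_simps)
next
  fix s p assume "s \<in> H_of (free_alg A)" "p \<in> V_of (free_alg A)"
  then show "act (free_alg A) s p \<in> H_of (free_alg A)"
    by (simp add: plug_labels)
qed (auto simp: plug_ctx_comp)


section \<open>The wreath product\<close>

text \<open>Maps from the second horizontal carrier to the first vertical one are extensional.\<close>

definition wreath ::
  "('h, 'v) forest_alg \<Rightarrow> ('k, 'w) forest_alg \<Rightarrow> ('h \<times> 'k, ('k \<Rightarrow> 'v) \<times> 'w) forest_alg" where
  "wreath F G =
    \<lparr>hmon = hmon F \<times>\<times> hmon G,
     vmon = \<lparr>carrier = (H_of G \<rightarrow>\<^sub>E V_of F) \<times> V_of G,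
             mult = (\<lambda>(f, v) (f', v').
               (\<lambda>k \<in> H_of G. vmult F (f k) (f' (act G k v)), vmult G v v')),
             one = (\<lambda>k \<in> H_of G. \<one>\<^bsub>vmon F\<^esub>, \<one>\<^bsub>vmon G\<^esub>)\<rparr>,
     act = (\<lambda>(h, k) (f, v). (act F h (f k), act G k v))\<rparr>"

lemma wreath_simps [simp]:
  "hmon (wreath F G) = hmon F \<times>\<times> hmon G"
  "V_of (wreath F G) = (H_of G \<rightarrow>\<^sub>E V_of F) \<times> V_of G"
  "vmult (wreath F G) (f, v) (f', v') =
    (\<lambda>k \<in> H_of G. vmult F (f k) (f' (act G k v)), vmult G v v')"
  "\<one>\<^bsub>vmon (wreath F G)\<^esub> = (\<lambda>k \<in> H_of G. \<one>\<^bsub>vmon F\<^esub>, \<one>\<^bsub>vmon G\<^esub>)"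
  "act (wreath F G) (h, k) (f, v) = (act F h (f k), act G k v)"
  by (auto simp: wreath_def)

lemma PiE_app: "f \<in> A \<rightarrow>\<^sub>E B \<Longrightarrow> k \<in> A \<Longrightarrow> f k \<in> B"
  by auto

lemma forest_algebra_wreath:
  assumes "forest_algebra F" "forest_algebra G"
  shows "forest_algebra (wreath F G)"
proof -
  interpret F: forest_algebra F by fact
  interpret G: forest_algebra G by fact
  interpret FH: comm_monoid "hmon F" by (rule F.hmon_comm_monoid)
  interpret GH: comm_monoid "hmon G" by (rule G.hmon_comm_monoid)
  interpret FV: monoid "vmon F" by (rule F.vmon_monoid)
  interpret GV: monoid "vmon G" by (rule G.vmon_monoid)
  note cl = F.act_closed G.act_closed
  show ?thesis
  proof (rule forest_algebra.intro)
    show "comm_monoid (hmon (wreath F G))"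
    proof (rule monoid.monoid_comm_monoidI)
      show "monoid (hmon (wreath F G))"
        by (simp add: DirProd_monoid FH.monoid_axioms GH.monoid_axioms)
    qed (auto simp: DirProd_def FH.m_comm GH.m_comm)
  next
    show "monoid (vmon (wreath F G))"
    proof (rule monoidI)
      fix x y assume "x \<in> V_of (wreath F G)" "y \<in> V_of (wreath F G)"
      then show "vmult (wreath F G) x y \<in> V_of (wreath F G)"
        by (cases x; cases y) (auto intro!: FV.m_closed GV.m_closed simp: PiE_app cl)
    next
      fix x y z
      assume "x \<in> V_of (wreath F G)" "y \<in> V_of (wreath F G)" "z \<in> V_of (wreath F G)"
      then obtain f u g v h w where xyz: "x = (f, u)" "y = (g, v)" "z = (h, w)"
        and mem: "f \<in> H_of G \<rightarrow> V_of F" "g \<in> H_of G \<rightarrow> V_of F" "h \<in> H_of G \<rightarrow> V_of F"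
          "u \<in> V_of G" "v \<in> V_of G" "w \<in> V_of G"
        by (cases x; cases y; cases z) (auto simp: PiE_def)
      have "vmult F (vmult F (f k) (g (act G k u))) (h (act G k (vmult G u v))) =
          vmult F (f k) (vmult F (g (act G k u)) (h (act G (act G k u) v)))" if "k \<in> H_of G" for k
      proof -
        have "act G k u \<in> H_of G" "act G (act G k u) v \<in> H_of G"
          using that mem G.act_closed by blast+
        then have "f k \<in> V_of F" "g (act G k u) \<in> V_of F" "h (act G (act G k u) v) \<in> V_of F"
          using that mem by blast+
        then show ?thesis
          using that mem by (simp add: FV.m_assoc flip: G.act_mult)
      qed
      then show "vmult (wreath F G) (vmult (wreath F G) x y) z =
          vmult (wreath F G) x (vmult (wreath F G) y z)"
        using xyz mem by (auto simp: G.act_closed GV.m_assoc fun_eq_iff)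
    next
      show "\<one>\<^bsub>vmon (wreath F G)\<^esub> \<in> V_of (wreath F G)" by auto
    next
      fix x assume "x \<in> V_of (wreath F G)"
      then obtain f v where x: "x = (f, v)" "f \<in> H_of G \<rightarrow>\<^sub>E V_of F" "v \<in> V_of G"
        by (cases x) auto
      then have f: "f k \<in> V_of F" if "k \<in> H_of G" for k using that by blast
      have ext: "(\<lambda>k \<in> H_of G. f k) = f" using x by (auto simp: PiE_def extensional_restrict)
      have "(\<lambda>k \<in> H_of G. vmult F \<one>\<^bsub>vmon F\<^esub> (f (act G k \<one>\<^bsub>vmon G\<^esub>))) = (\<lambda>k \<in> H_of G. f k)"
        using f by (intro restrict_ext) (simp add: G.act_one)
      then show "vmult (wreath F G) \<one>\<^bsub>vmon (wreath F G)\<^esub> x = x"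
        using x ext by (simp add: restrict_def cong: if_cong)
      have "vmult F (f k) \<one>\<^bsub>vmon F\<^esub> = f k" if "k \<in> H_of G" for k
        using f that by simp
      then show "vmult (wreath F G) x \<one>\<^bsub>vmon (wreath F G)\<^esub> = x"
        using x ext G.act_closed by (auto simp: restrict_def fun_eq_iff)
    qed
  next
    fix x y assume "x \<in> H_of (wreath F G)" "y \<in> V_of (wreath F G)"
    then show "act (wreath F G) x y \<in> H_of (wreath F G)"
      by (cases x; cases y) (auto simp: PiE_app cl)
  next
    fix x y z assume "x \<in> H_of (wreath F G)" "y \<in> V_of (wreath F G)" "z \<in> V_of (wreath F G)"
    then show "act (wreath F G) (act (wreath F G) x y) z =
        act (wreath F G) x (vmult (wreath F G) y z)"
      by (cases x; cases y; cases z) (auto simp: PiE_app cl F.act_mult G.act_mult)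
  next
    fix x assume "x \<in> H_of (wreath F G)"
    then show "act (wreath F G) x \<one>\<^bsub>vmon (wreath F G)\<^esub> = x"
      by (cases x) (auto simp: F.act_one G.act_one)
  next
    fix x y assume x: "x \<in> V_of (wreath F G)" and y: "y \<in> V_of (wreath F G)"
      and eq: "\<And>h. h \<in> H_of (wreath F G) \<Longrightarrow> act (wreath F G) h x = act (wreath F G) h y"
    obtain f v f' v' where xy: "x = (f, v)" "y = (f', v')" by (cases x; cases y) auto
    have *: "act F h (f k) = act F h (f' k) \<and> act G k v = act G k v'"
      if "h \<in> H_of F" "k \<in> H_of G" for h k
      using eq[of "(h, k)"] that xy by auto
    have "v = v'" using x y xy * FH.one_closed by (intro G.faithful) auto
    moreover have "f = f'"
      using x y xy * by (intro PiE_ext[of f "H_of G" "\<lambda>_. V_of F" f']) (auto intro!: F.faithful simp: PiE_app)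
    ultimately show "x = y" using xy by simp
  next
    fix x y assume x: "x \<in> V_of (wreath F G)" and y: "y \<in> H_of (wreath F G)"
    obtain f v h k where xy: "x = (f, v)" "y = (h, k)" by (cases x; cases y) auto
    show "\<exists>w\<in>V_of (wreath F G). \<forall>g\<in>H_of (wreath F G).
        act (wreath F G) g w = hadd (wreath F G) (act (wreath F G) g x) y"
      using x y xy
      by (intro bexI[of _ "(\<lambda>k' \<in> H_of G. vadd F (f k') h, vadd G v k)"])
        (auto simp: PiE_app F.act_vadd G.act_vadd F.vadd_closed G.vadd_closed)
  qed
qed


section \<open>Forest categories\<close>

text \<open>
  \<open>harrs\<close> is the monoid of all half-arrows, \<open>ccomp\<close> the composition of arrows, \<open>cact\<close> the action
  of arrows on half-arrows, and \<open>cadd\<close> the operation \<open>u + c\<close>.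
\<close>

record ('o, 'c, 'r) forest_cat =
  objs :: "'o monoid"
  harrs :: "'c monoid"
  HArr :: "'o \<Rightarrow> 'c set"
  Arr :: "'o \<Rightarrow> 'o \<Rightarrow> 'r set"
  ident :: "'o \<Rightarrow> 'r"
  ccomp :: "'r \<Rightarrow> 'r \<Rightarrow> 'r"
  cact :: "'c \<Rightarrow> 'r \<Rightarrow> 'c"
  cadd :: "'r \<Rightarrow> 'c \<Rightarrow> 'r"

abbreviation Obj :: "('o, 'c, 'r, 'm) forest_cat_scheme \<Rightarrow> 'o set" where
  "Obj C \<equiv> carrier (objs C)"

locale forest_category =
  fixes C :: "('o, 'c, 'r, 'm) forest_cat_scheme"
  assumes finite_Obj: "finite (Obj C)"
    and objs_comm_monoid: "comm_monoid (objs C)"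
    and Arr_disjoint: "x \<in> Obj C \<Longrightarrow> y \<in> Obj C \<Longrightarrow> x' \<in> Obj C \<Longrightarrow> y' \<in> Obj C \<Longrightarrow>
      (x, y) \<noteq> (x', y') \<Longrightarrow> Arr C x y \<inter> Arr C x' y' = {}"
    and HArr_disjoint: "x \<in> Obj C \<Longrightarrow> y \<in> Obj C \<Longrightarrow> x \<noteq> y \<Longrightarrow> HArr C x \<inter> HArr C y = {}"
    and harrs_comm_monoid: "comm_monoid (harrs C)"
    and harrs_carrier: "carrier (harrs C) = (\<Union>x \<in> Obj C. HArr C x)"
    and HArr_add: "x \<in> Obj C \<Longrightarrow> y \<in> Obj C \<Longrightarrow> c \<in> HArr C x \<Longrightarrow> d \<in> HArr C y \<Longrightarrow>
      c \<otimes>\<^bsub>harrs C\<^esub> d \<in> HArr C (x \<otimes>\<^bsub>objs C\<^esub> y)"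
    and HArr_zero: "\<one>\<^bsub>harrs C\<^esub> \<in> HArr C \<one>\<^bsub>objs C\<^esub>"
    and HArr_onto: "x \<in> Obj C \<Longrightarrow> HArr C x \<noteq> {}"
    and comp_closed: "x \<in> Obj C \<Longrightarrow> y \<in> Obj C \<Longrightarrow> z \<in> Obj C \<Longrightarrow>
      u \<in> Arr C x y \<Longrightarrow> v \<in> Arr C y z \<Longrightarrow> ccomp C u v \<in> Arr C x z"
    and comp_assoc: "x \<in> Obj C \<Longrightarrow> y \<in> Obj C \<Longrightarrow> z \<in> Obj C \<Longrightarrow> z' \<in> Obj C \<Longrightarrow>
      u \<in> Arr C x y \<Longrightarrow> v \<in> Arr C y z \<Longrightarrow> w \<in> Arr C z z' \<Longrightarrow>
      ccomp C (ccomp C u v) w = ccomp C u (ccomp C v w)"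
    and ident_closed: "x \<in> Obj C \<Longrightarrow> ident C x \<in> Arr C x x"
    and ident_left: "x \<in> Obj C \<Longrightarrow> y \<in> Obj C \<Longrightarrow> u \<in> Arr C x y \<Longrightarrow> ccomp C (ident C x) u = u"
    and ident_right: "x \<in> Obj C \<Longrightarrow> y \<in> Obj C \<Longrightarrow> u \<in> Arr C x y \<Longrightarrow> ccomp C u (ident C y) = u"
    and cact_closed: "x \<in> Obj C \<Longrightarrow> y \<in> Obj C \<Longrightarrow> c \<in> HArr C x \<Longrightarrow> u \<in> Arr C x y \<Longrightarrow>
      cact C c u \<in> HArr C y"
    and cact_comp: "x \<in> Obj C \<Longrightarrow> y \<in> Obj C \<Longrightarrow> z \<in> Obj C \<Longrightarrow>
      c \<in> HArr C x \<Longrightarrow> u \<in> Arr C x y \<Longrightarrow> v \<in> Arr C y z \<Longrightarrow>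
      cact C (cact C c u) v = cact C c (ccomp C u v)"
    and cact_ident: "x \<in> Obj C \<Longrightarrow> c \<in> HArr C x \<Longrightarrow> cact C c (ident C x) = c"
    and cact_faithful: "x \<in> Obj C \<Longrightarrow> y \<in> Obj C \<Longrightarrow> u \<in> Arr C x y \<Longrightarrow> u' \<in> Arr C x y \<Longrightarrow>
      (\<And>c. c \<in> HArr C x \<Longrightarrow> cact C c u = cact C c u') \<Longrightarrow> u = u'"
    and cadd_closed: "x \<in> Obj C \<Longrightarrow> y \<in> Obj C \<Longrightarrow> z \<in> Obj C \<Longrightarrow> u \<in> Arr C x y \<Longrightarrow>
      c \<in> HArr C z \<Longrightarrow> cadd C u c \<in> Arr C x (y \<otimes>\<^bsub>objs C\<^esub> z)"
    and comp_cadd: "x' \<in> Obj C \<Longrightarrow> x \<in> Obj C \<Longrightarrow> y \<in> Obj C \<Longrightarrow> z \<in> Obj C \<Longrightarrow>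
      f \<in> Arr C x' x \<Longrightarrow> u \<in> Arr C x y \<Longrightarrow> c \<in> HArr C z \<Longrightarrow>
      ccomp C f (cadd C u c) = cadd C (ccomp C f u) c"
    and cadd_cadd: "x \<in> Obj C \<Longrightarrow> y \<in> Obj C \<Longrightarrow> z \<in> Obj C \<Longrightarrow> z' \<in> Obj C \<Longrightarrow>
      u \<in> Arr C x y \<Longrightarrow> c \<in> HArr C z \<Longrightarrow> d \<in> HArr C z' \<Longrightarrow>
      cadd C (cadd C u c) d = cadd C u (c \<otimes>\<^bsub>harrs C\<^esub> d)"

definition cat_divides ::
  "('o, 'c, 'r, 'm) forest_cat_scheme \<Rightarrow> ('h, 'v, 'n) forest_alg_scheme \<Rightarrow> bool" where
  "cat_divides C F \<longleftrightarrow>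
    (\<exists>(KH :: 'c \<Rightarrow> 'h set) (KV :: 'r \<Rightarrow> 'v set).
      (\<forall>x \<in> Obj C. \<forall>c \<in> HArr C x. KH c \<subseteq> H_of F \<and> KH c \<noteq> {}) \<and>
      (\<forall>x \<in> Obj C. \<forall>y \<in> Obj C. \<forall>u \<in> Arr C x y. KV u \<subseteq> V_of F \<and> KV u \<noteq> {}) \<and>
      (\<forall>x \<in> Obj C. \<forall>y \<in> Obj C. \<forall>z \<in> Obj C. \<forall>u \<in> Arr C x y. \<forall>v \<in> Arr C y z.
        \<forall>k \<in> KV u. \<forall>l \<in> KV v. vmult F k l \<in> KV (ccomp C u v)) \<and>
      (\<forall>x \<in> Obj C. \<forall>y \<in> Obj C. \<forall>c \<in> HArr C x. \<forall>u \<in> Arr C x y.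
        \<forall>k \<in> KH c. \<forall>l \<in> KV u. act F k l \<in> KH (cact C c u)) \<and>
      (\<forall>x \<in> Obj C. \<forall>y \<in> Obj C. \<forall>c \<in> HArr C x. \<forall>d \<in> HArr C y.
        \<forall>k \<in> KH c. \<forall>l \<in> KH d. hadd F k l \<in> KH (c \<otimes>\<^bsub>harrs C\<^esub> d)) \<and>
      (\<forall>x \<in> Obj C. \<forall>y \<in> Obj C. \<forall>z \<in> Obj C. \<forall>u \<in> Arr C x y. \<forall>c \<in> HArr C z.
        \<forall>k \<in> KV u. \<forall>l \<in> KH c. vadd F k l \<in> KV (cadd C u c)) \<and>
      (\<forall>x \<in> Obj C. \<forall>y \<in> Obj C. \<forall>u \<in> Arr C x y. \<forall>u' \<in> Arr C x y.
        u \<noteq> u' \<longrightarrow> KV u \<inter> KV u' = {}) \<and>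
      (\<forall>y \<in> Obj C. \<forall>c \<in> HArr C y. \<forall>c' \<in> HArr C y.
        c \<noteq> c' \<longrightarrow> KH c \<inter> KH c' = {}))"


section \<open>The derived category\<close>

text \<open>
  Throughout, \<open>\<alpha>H\<close>, \<open>\<alpha>V\<close> and \<open>\<beta>H\<close>, \<open>\<beta>V\<close> are the horizontal and vertical components of
  homomorphisms from \<open>free_alg A\<close> to \<open>F1\<close> and to \<open>F2\<close>.
\<close>

definition derived_triples ::
  "'a set \<Rightarrow> ('k, 'w) forest_alg \<Rightarrow> ('a ctx \<Rightarrow> 'w) \<Rightarrow> 'k \<Rightarrow> 'k \<Rightarrow> ('k \<times> 'a ctx \<times> 'k) set" where
  "derived_triples A F2 \<beta>V h h' = {(h, p, h') | p. p \<in> V_of (free_alg A) \<and> act F2 h (\<beta>V p) = h'}"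

definition derived_rel ::
  "'a set \<Rightarrow> ('k, 'w) forest_alg \<Rightarrow> ('a forest \<Rightarrow> 'h) \<Rightarrow> ('a forest \<Rightarrow> 'k) \<Rightarrow> ('a ctx \<Rightarrow> 'w) \<Rightarrow>
    (('k \<times> 'a ctx \<times> 'k) \<times> ('k \<times> 'a ctx \<times> 'k)) set" where
  "derived_rel A F2 \<alpha>H \<beta>H \<beta>V =
    {((h, p, h'), (h, q, h')) | h p q h'. h \<in> H_of F2 \<and> h' \<in> H_of F2 \<and>
      (h, p, h') \<in> derived_triples A F2 \<beta>V h h' \<and> (h, q, h') \<in> derived_triples A F2 \<beta>V h h' \<and>
      (\<forall>s \<in> H_of (free_alg A). \<beta>H s = h \<longrightarrow> \<alpha>H (plug s p) = \<alpha>H (plug s q))}"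

text \<open>
  The operations on classes are defined through representatives: each image below is a singleton,
  as the lemmas \<open>derived_comp\<close>, \<open>derived_act\<close> and \<open>derived_add\<close> show.
\<close>

definition derived_category ::
  "'a set \<Rightarrow> ('h, 'v) forest_alg \<Rightarrow> ('k, 'w) forest_alg \<Rightarrow>
    ('a forest \<Rightarrow> 'h) \<Rightarrow> ('a ctx \<Rightarrow> 'v) \<Rightarrow> ('a forest \<Rightarrow> 'k) \<Rightarrow> ('a ctx \<Rightarrow> 'w) \<Rightarrow>
    ('k, 'h \<times> 'k, ('k \<times> 'a ctx \<times> 'k) set) forest_cat" where
  "derived_category A F1 F2 \<alpha>H \<alpha>V \<beta>H \<beta>V =
    (let cls = (\<lambda>t. derived_rel A F2 \<alpha>H \<beta>H \<beta>V `` {t}) in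
    \<lparr>objs = hmon F2,
     harrs = (hmon F1 \<times>\<times> hmon F2)\<lparr>carrier := (\<lambda>s. (\<alpha>H s, \<beta>H s)) ` H_of (free_alg A)\<rparr>,
     HArr = (\<lambda>h. {(\<alpha>H s, h) | s. s \<in> H_of (free_alg A) \<and> \<beta>H s = h}),
     Arr = (\<lambda>h h'. derived_triples A F2 \<beta>V h h' // derived_rel A F2 \<alpha>H \<beta>H \<beta>V),
     ident = (\<lambda>h. cls (h, Hole {#}, h)),
     ccomp = (\<lambda>u v. the_elem
       ((\<lambda>((h, p, h'), (k, q, h'')). cls (h, ctx_comp p q, h'')) ` (u \<times> v))),
     cact = (\<lambda>(g, h) u. the_elem ((\<lambda>(k, p, h'). (act F1 g (\<alpha>V p), h')) ` u)),
     cadd = (\<lambda>u c. the_elem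
       ((\<lambda>((h, p, h'), s). cls (h, ctx_add p s, hadd F2 h' (\<beta>H s))) `
         (u \<times> {s \<in> H_of (free_alg A). (\<alpha>H s, \<beta>H s) = c})))\<rparr>)"

locale derived_setup =
  F1: finite_forest_algebra F1 + F2: finite_forest_algebra F2
  for F1 :: "('h, 'v) forest_alg" and F2 :: "('k, 'w) forest_alg" +
  fixes A :: "'a set" and \<alpha>H \<alpha>V \<beta>H \<beta>V
  assumes \<alpha>: "forest_surj_hom (free_alg A) F1 \<alpha>H \<alpha>V"
    and \<beta>: "forest_surj_hom (free_alg A) F2 \<beta>H \<beta>V"
begin

definition cls :: "'k \<Rightarrow> 'a ctx \<Rightarrow> 'k \<Rightarrow> ('k \<times> 'a ctx \<times> 'k) set" where
  "cls h p h' = derived_rel A F2 \<alpha>H \<beta>H \<beta>V `` {(h, p, h')}"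

abbreviation D :: "('k, 'h \<times> 'k, ('k \<times> 'a ctx \<times> 'k) set) forest_cat" where
  "D \<equiv> derived_category A F1 F2 \<alpha>H \<alpha>V \<beta>H \<beta>V"

abbreviation "HA \<equiv> H_of (free_alg A)"
abbreviation "VA \<equiv> V_of (free_alg A)"

lemma hom_simps:
  "\<alpha>H {#} = \<one>\<^bsub>hmon F1\<^esub>" "\<alpha>V (Hole {#}) = \<one>\<^bsub>vmon F1\<^esub>"
  "\<beta>H {#} = \<one>\<^bsub>hmon F2\<^esub>" "\<beta>V (Hole {#}) = \<one>\<^bsub>vmon F2\<^esub>"
  "s \<in> HA \<Longrightarrow> \<alpha>H s \<in> H_of F1" "s \<in> HA \<Longrightarrow> \<beta>H s \<in> H_of F2"
  "p \<in> VA \<Longrightarrow> \<alpha>V p \<in> V_of F1" "p \<in> VA \<Longrightarrow> \<beta>V p \<in> V_of F2"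
  "s \<in> HA \<Longrightarrow> t \<in> HA \<Longrightarrow> \<alpha>H (s + t) = hadd F1 (\<alpha>H s) (\<alpha>H t)"
  "s \<in> HA \<Longrightarrow> t \<in> HA \<Longrightarrow> \<beta>H (s + t) = hadd F2 (\<beta>H s) (\<beta>H t)"
  "p \<in> VA \<Longrightarrow> q \<in> VA \<Longrightarrow> \<alpha>V (ctx_comp p q) = vmult F1 (\<alpha>V p) (\<alpha>V q)"
  "p \<in> VA \<Longrightarrow> q \<in> VA \<Longrightarrow> \<beta>V (ctx_comp p q) = vmult F2 (\<beta>V p) (\<beta>V q)"
  "s \<in> HA \<Longrightarrow> p \<in> VA \<Longrightarrow> \<alpha>H (plug s p) = act F1 (\<alpha>H s) (\<alpha>V p)"
  "s \<in> HA \<Longrightarrow> p \<in> VA \<Longrightarrow> \<beta>H (plug s p) = act F2 (\<beta>H s) (\<beta>V p)"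
  using \<alpha> \<beta> unfolding forest_surj_hom_def forest_hom_def monoid_hom_def hom_def
  by (auto simp del: free_alg_simps(1,2))

lemma free_closed:
  "s \<in> HA \<Longrightarrow> p \<in> VA \<Longrightarrow> plug s p \<in> HA"
  "p \<in> VA \<Longrightarrow> q \<in> VA \<Longrightarrow> ctx_comp p q \<in> VA"
  "p \<in> VA \<Longrightarrow> s \<in> HA \<Longrightarrow> ctx_add p s \<in> VA"
  "s \<in> HA \<Longrightarrow> t \<in> HA \<Longrightarrow> s + t \<in> HA"
  "{#} \<in> HA" "Hole {#} \<in> VA"
  by (auto simp: plug_labels ctx_comp_labels ctx_add_labels)

lemma \<beta>_onto: "h \<in> H_of F2 \<Longrightarrow> \<exists>s \<in> HA. \<beta>H s = h"
  using \<beta> unfolding forest_surj_hom_def by (metis imageE)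

lemma act_\<beta>V_add:
  assumes "h \<in> H_of F2" "p \<in> VA" "s \<in> HA"
  shows "act F2 h (\<beta>V (ctx_add p s)) = hadd F2 (act F2 h (\<beta>V p)) (\<beta>H s)"
proof -
  obtain t where t: "t \<in> HA" "\<beta>H t = h" using \<beta>_onto assms(1) by blast
  have "act F2 h (\<beta>V (ctx_add p s)) = \<beta>H (plug t (ctx_add p s))"
    using t assms by (simp add: hom_simps free_closed del: free_alg_simps(1,2))
  also have "\<dots> = \<beta>H (plug t p + s)" by (simp only: plug_ctx_add)
  finally show ?thesis
    using t assms by (simp add: hom_simps free_closed del: free_alg_simps(1,2))
qed

lemma mem_cls_iff:
  assumes h: "h \<in> H_of F2" and p: "p \<in> VA" and h': "act F2 h (\<beta>V p) = h'"
  shows "t \<in> cls h p h' \<longleftrightarrow> (\<exists>q \<in> VA. t = (h, q, h') \<and> act F2 h (\<beta>V q) = h' \<and>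
    (\<forall>s \<in> HA. \<beta>H s = h \<longrightarrow> \<alpha>H (plug s p) = \<alpha>H (plug s q)))"
proof -
  have "h' \<in> H_of F2"
    using F2.act_closed[OF h hom_simps(8)[OF p]] h' by simp
  then show ?thesis using assms unfolding cls_def derived_triples_def derived_rel_def by blast
qed

lemma cls_eq_iff:
  assumes h: "h \<in> H_of F2" and p: "p \<in> VA" and q: "q \<in> VA"
    and hp: "act F2 h (\<beta>V p) = h'" and hq: "act F2 h (\<beta>V q) = h'"
  shows "cls h p h' = cls h q h' \<longleftrightarrow>
    (\<forall>s \<in> HA. \<beta>H s = h \<longrightarrow> \<alpha>H (plug s p) = \<alpha>H (plug s q))" (is "?L \<longleftrightarrow> ?R")
proof
  assume ?L
  moreover have "(h, q, h') \<in> cls h q h'" using mem_cls_iff[OF h q hq] q hq by blast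
  ultimately show ?R using mem_cls_iff[OF h p hp] by blast
next
  assume R: ?R
  have "t \<in> cls h p h' \<longleftrightarrow> t \<in> cls h q h'" for t
    unfolding mem_cls_iff[OF h p hp] mem_cls_iff[OF h q hq] using R by metis
  then show ?L by blast
qed

lemma mem_cls:
  assumes h: "h \<in> H_of F2" and p: "p \<in> VA" and h': "act F2 h (\<beta>V p) = h'"
  shows "t \<in> cls h p h' \<longleftrightarrow>
    (\<exists>q \<in> VA. t = (h, q, h') \<and> act F2 h (\<beta>V q) = h' \<and> cls h q h' = cls h p h')"
  unfolding mem_cls_iff[OF h p h'] using cls_eq_iff[OF h p _ h'] by metis

lemma derived_simps [simp]:
  "objs D = hmon F2"
  "harrs D = (hmon F1 \<times>\<times> hmon F2)\<lparr>carrier := (\<lambda>s. (\<alpha>H s, \<beta>H s)) ` HA\<rparr>"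
  "HArr D h = {(\<alpha>H s, h) | s. s \<in> HA \<and> \<beta>H s = h}"
  "ident D h = cls h (Hole {#}) h"
  unfolding derived_category_def cls_def by (simp_all add: Let_def del: free_alg_simps(1,2))

lemma derived_Arr:
  "Arr D h h' = {cls h p h' | p. p \<in> VA \<and> act F2 h (\<beta>V p) = h'}"
  unfolding derived_category_def cls_def quotient_def derived_triples_def
  by (auto simp: Let_def simp del: free_alg_simps(1,2))

lemma the_elem_const:
  assumes "X \<noteq> {}" and "\<And>x. x \<in> X \<Longrightarrow> f x = c"
  shows "the_elem (f ` X) = c"
proof -
  have "f ` X = {c}" using assms by (auto simp: image_iff intro: sym)
  then show ?thesis by simp
qed

lemma cls_refl: "h \<in> H_of F2 \<Longrightarrow> p \<in> VA \<Longrightarrow> act F2 h (\<beta>V p) = h' \<Longrightarrow> (h, p, h') \<in> cls h p h'"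
  by (subst mem_cls) (auto simp del: free_alg_simps(1,2))

lemma derived_comp:
  assumes h: "h \<in> H_of F2" and p: "p \<in> VA" and q: "q \<in> VA"
    and h': "act F2 h (\<beta>V p) = h'" and h'': "act F2 h' (\<beta>V q) = h''"
  shows "ccomp D (cls h p h') (cls h' q h'') = cls h (ctx_comp p q) h''"
proof -
  have h'F: "h' \<in> H_of F2"
    using F2.act_closed[OF h hom_simps(8)[OF p]] h' by simp
  have "ccomp D (cls h p h') (cls h' q h'') = the_elem
       ((\<lambda>((h, p, h'), (k, q, h'')). cls h (ctx_comp p q) h'') ` (cls h p h' \<times> cls h' q h''))"
    unfolding derived_category_def by (simp add: Let_def cls_def del: free_alg_simps(1,2))
  also have "\<dots> = cls h (ctx_comp p q) h''"
  proof (rule the_elem_const)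
    show "cls h p h' \<times> cls h' q h'' \<noteq> {}"
      using cls_refl[OF h p h'] cls_refl[OF h'F q h''] by blast
  next
    fix x assume "x \<in> cls h p h' \<times> cls h' q h''"
    then obtain p' q' where x: "x = ((h, p', h'), (h', q', h''))"
      and p': "p' \<in> VA" "act F2 h (\<beta>V p') = h'" "cls h p' h' = cls h p h'"
      and q': "q' \<in> VA" "act F2 h' (\<beta>V q') = h''" "cls h' q' h'' = cls h' q h''"
      using mem_cls[OF h p h'] mem_cls[OF h'F q h''] by (auto simp del: free_alg_simps(1,2))
    have a: "act F2 h (\<beta>V (ctx_comp p q)) = h''" "act F2 h (\<beta>V (ctx_comp p' q')) = h''"
      using h p q p' q' h' h'' by (simp_all add: hom_simps flip: F2.act_mult del: free_alg_simps(1,2))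
    have "\<alpha>H (plug s (ctx_comp p' q')) = \<alpha>H (plug s (ctx_comp p q))"
      if s: "s \<in> HA" "\<beta>H s = h" for s
    proof -
      have "\<alpha>H (plug s p') = \<alpha>H (plug s p)"
        using p' p h h' s cls_eq_iff by blast
      moreover have "\<alpha>H (plug (plug s p) q') = \<alpha>H (plug (plug s p) q)"
      proof -
        have "plug s p \<in> HA" "\<beta>H (plug s p) = h'"
          using s p h' by (auto simp: hom_simps free_closed simp del: free_alg_simps(1,2))
        then show ?thesis using q' q h'' h'F cls_eq_iff by blast
      qed
      ultimately show ?thesis
        using s p p' q' by (simp add: plug_ctx_comp hom_simps free_closed del: free_alg_simps(1,2))
    qed
    then have "cls h (ctx_comp p' q') h'' = cls h (ctx_comp p q) h''"
      using a h p q p' q' by (subst cls_eq_iff) (auto simp: free_closed simp del: free_alg_simps(1,2))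
    then show "(\<lambda>((h, p, h'), (k, q, h'')). cls h (ctx_comp p q) h'') x =
        cls h (ctx_comp p q) h''"
      using x by simp
  qed
  finally show ?thesis .
qed

lemma derived_act:
  assumes s: "s \<in> HA" and p: "p \<in> VA" and h: "h = \<beta>H s" and h': "act F2 h (\<beta>V p) = h'"
  shows "cact D (\<alpha>H s, h) (cls h p h') = (act F1 (\<alpha>H s) (\<alpha>V p), h')"
proof -
  have hF: "h \<in> H_of F2" using hom_simps(6)[OF s] h by simp
  have "cact D (\<alpha>H s, h) (cls h p h') = the_elem
       ((\<lambda>(k, p, h'). (act F1 (\<alpha>H s) (\<alpha>V p), h')) ` cls h p h')"
    unfolding derived_category_def by (simp add: Let_def del: free_alg_simps(1,2))
  also have "\<dots> = (act F1 (\<alpha>H s) (\<alpha>V p), h')"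
  proof (rule the_elem_const)
    show "cls h p h' \<noteq> {}" using cls_refl[OF hF p h'] by blast
  next
    fix x assume "x \<in> cls h p h'"
    then obtain p' where x: "x = (h, p', h')"
      and p': "p' \<in> VA" "act F2 h (\<beta>V p') = h'" "cls h p' h' = cls h p h'"
      using mem_cls[OF hF p h'] by (auto simp del: free_alg_simps(1,2))
    have "\<alpha>H (plug s p') = \<alpha>H (plug s p)"
      using p' p h h' s hF cls_eq_iff by blast
    then show "(\<lambda>(k, p, h'). (act F1 (\<alpha>H s) (\<alpha>V p), h')) x = (act F1 (\<alpha>H s) (\<alpha>V p), h')"
      using x p p' s by (simp add: hom_simps del: free_alg_simps(1,2))
  qed
  finally show ?thesis .
qed

lemma derived_add:
  assumes h: "h \<in> H_of F2" and p: "p \<in> VA" and h': "act F2 h (\<beta>V p) = h'" and s: "s \<in> HA"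
  shows "cadd D (cls h p h') (\<alpha>H s, \<beta>H s) = cls h (ctx_add p s) (hadd F2 h' (\<beta>H s))"
proof -
  let ?S = "{t \<in> HA. (\<alpha>H t, \<beta>H t) = (\<alpha>H s, \<beta>H s)}"
  have "cadd D (cls h p h') (\<alpha>H s, \<beta>H s) = the_elem
       ((\<lambda>((h, p, h'), s). cls h (ctx_add p s) (hadd F2 h' (\<beta>H s))) ` (cls h p h' \<times> ?S))"
    unfolding derived_category_def by (simp add: Let_def cls_def del: free_alg_simps(1,2))
  also have "\<dots> = cls h (ctx_add p s) (hadd F2 h' (\<beta>H s))"
  proof (rule the_elem_const)
    show "cls h p h' \<times> ?S \<noteq> {}" using cls_refl[OF h p h'] s by blast
  next
    fix x assume "x \<in> cls h p h' \<times> ?S"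
    then obtain p' s' where x: "x = ((h, p', h'), s')"
      and p': "p' \<in> VA" "act F2 h (\<beta>V p') = h'" "cls h p' h' = cls h p h'"
      and s': "s' \<in> HA" "\<alpha>H s' = \<alpha>H s" "\<beta>H s' = \<beta>H s"
      using mem_cls[OF h p h'] by (auto simp del: free_alg_simps(1,2))
    have "\<alpha>H (plug t (ctx_add p' s')) = \<alpha>H (plug t (ctx_add p s))"
      if t: "t \<in> HA" "\<beta>H t = h" for t
    proof -
      have "\<alpha>H (plug t p') = \<alpha>H (plug t p)"
        using p' p h h' t cls_eq_iff by blast
      then show ?thesis using t p p' s s'
        by (simp add: plug_ctx_add hom_simps(9) free_closed del: free_alg_simps(1,2))
    qed
    then have "cls h (ctx_add p' s') (hadd F2 h' (\<beta>H s)) = cls h (ctx_add p s) (hadd F2 h' (\<beta>H s))"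
      using h p p' s s' h' act_\<beta>V_add
      by (subst cls_eq_iff) (auto simp: free_closed simp del: free_alg_simps(1,2))
    then show "(\<lambda>((h, p, h'), s). cls h (ctx_add p s) (hadd F2 h' (\<beta>H s))) x =
        cls h (ctx_add p s) (hadd F2 h' (\<beta>H s))"
      using x s' by simp
  qed
  finally show ?thesis .
qed

theorem forest_category_derived: "forest_category D"
proof -
  interpret H1: comm_monoid "hmon F1" by (rule F1.hmon_comm_monoid)
  interpret H2: comm_monoid "hmon F2" by (rule F2.hmon_comm_monoid)
  note [simp del] = free_alg_simps(1,2)
  note [simp] = hom_simps free_closed derived_Arr plug_ctx_add plug_ctx_comp
  have comp\<beta>: "act F2 h (\<beta>V (ctx_comp p q)) = act F2 (act F2 h (\<beta>V p)) (\<beta>V q)"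
    if "h \<in> H_of F2" "p \<in> VA" "q \<in> VA" for h p q
    using that by (simp add: F2.act_mult)
  have one\<beta>: "act F2 h (\<beta>V (Hole {#})) = h" if "h \<in> H_of F2" for h
    using that by (simp add: F2.act_one)
  show ?thesis
  proof (rule forest_category.intro)
    show "finite (Obj D)" using F2.finite_H by simp
    show "comm_monoid (objs D)" by (simp add: F2.hmon_comm_monoid)
    show "comm_monoid (harrs D)"
    proof (rule comm_monoidI, goal_cases)
      case (1 x y)
      then obtain s t where "s \<in> HA" "t \<in> HA" "x = (\<alpha>H s, \<beta>H s)" "y = (\<alpha>H t, \<beta>H t)" by auto
      then show ?case by (auto simp: DirProd_def intro!: image_eqI[of _ _ "s + t"])
    next
      case 2 show ?case by (auto simp: DirProd_def intro!: image_eqI[of _ _ "{#}"])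
    next
      case (3 x y z) then show ?case by (auto simp: DirProd_def H1.m_assoc H2.m_assoc)
    next
      case (4 x) then show ?case by (auto simp: DirProd_def)
    next
      case (5 x y) then show ?case by (auto simp: DirProd_def H1.m_comm H2.m_comm)
    qed
    show "carrier (harrs D) = (\<Union>x\<in>Obj D. HArr D x)"
      using hom_simps(6) by (fastforce simp del: hom_simps)
    show "\<one>\<^bsub>harrs D\<^esub> \<in> HArr D \<one>\<^bsub>objs D\<^esub>"
      by (auto simp: DirProd_def intro!: exI[of _ "{#}"])
  next
    fix x y x' y' assume *: "x \<in> Obj D" "y \<in> Obj D" "x' \<in> Obj D" "y' \<in> Obj D" "(x, y) \<noteq> (x', y')"
    show "Arr D x y \<inter> Arr D x' y' = {}"
    proof (rule ccontr)
      assume "Arr D x y \<inter> Arr D x' y' \<noteq> {}"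
      then obtain p q where "p \<in> VA" "act F2 x (\<beta>V p) = y" "q \<in> VA" "act F2 x' (\<beta>V q) = y'"
        "cls x p y = cls x' q y'" by auto
      then have "(x, p, y) \<in> cls x' q y'" using * cls_refl by fastforce
      with * show False using mem_cls[of x' q y'] \<open>q \<in> VA\<close> \<open>act F2 x' (\<beta>V q) = y'\<close> by auto
    qed
  next
    fix x y assume "x \<in> Obj D" "y \<in> Obj D" "x \<noteq> y"
    then show "HArr D x \<inter> HArr D y = {}" by auto
  next
    fix x y c d assume "x \<in> Obj D" "y \<in> Obj D" "c \<in> HArr D x" "d \<in> HArr D y"
    then obtain s t where "s \<in> HA" "t \<in> HA" "c = (\<alpha>H s, \<beta>H s)" "d = (\<alpha>H t, \<beta>H t)"
      "\<beta>H s = x" "\<beta>H t = y" by auto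
    then show "c \<otimes>\<^bsub>harrs D\<^esub> d \<in> HArr D (x \<otimes>\<^bsub>objs D\<^esub> y)"
      by (auto simp: DirProd_def intro!: exI[of _ "s + t"])
  next
    fix x assume "x \<in> Obj D"
    then show "HArr D x \<noteq> {}" using \<beta>_onto[of x] by auto
  next
    fix x y z u v
    assume "x \<in> Obj D" "y \<in> Obj D" "z \<in> Obj D" "u \<in> Arr D x y" "v \<in> Arr D y z"
    then obtain p q where *: "p \<in> VA" "q \<in> VA" "u = cls x p y" "v = cls y q z"
      "act F2 x (\<beta>V p) = y" "act F2 y (\<beta>V q) = z" "x \<in> H_of F2" by auto
    then have "ccomp D u v = cls x (ctx_comp p q) z" "act F2 x (\<beta>V (ctx_comp p q)) = z"
      using derived_comp[of x p q y z] comp\<beta>[of x p q] by simp_all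
    then show "ccomp D u v \<in> Arr D x z"
      using * free_closed(2) unfolding derived_Arr by blast
  next
    fix x y z z' u v w
    assume "x \<in> Obj D" "y \<in> Obj D" "z \<in> Obj D" "z' \<in> Obj D"
      "u \<in> Arr D x y" "v \<in> Arr D y z" "w \<in> Arr D z z'"
    then obtain p q r where *: "p \<in> VA" "q \<in> VA" "r \<in> VA"
      "u = cls x p y" "v = cls y q z" "w = cls z r z'"
      "act F2 x (\<beta>V p) = y" "act F2 y (\<beta>V q) = z" "act F2 z (\<beta>V r) = z'"
      "x \<in> H_of F2" "y \<in> H_of F2" by auto
    have "ccomp D u v = cls x (ctx_comp p q) z" "ccomp D v w = cls y (ctx_comp q r) z'"
      "act F2 x (\<beta>V (ctx_comp p q)) = z" "act F2 y (\<beta>V (ctx_comp q r)) = z'"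
      using * derived_comp[of x p q y z] derived_comp[of y q r z z'] comp\<beta>[of x p q] comp\<beta>[of y q r]
      by simp_all
    then show "ccomp D (ccomp D u v) w = ccomp D u (ccomp D v w)"
      using * derived_comp[of x "ctx_comp p q" r z z'] derived_comp[of x p "ctx_comp q r" y z']
        free_closed(2)
      by (simp add: ctx_comp_assoc del: hom_simps)
  next
    fix x assume "x \<in> Obj D"
    then show "ident D x \<in> Arr D x x"
      by (auto simp: F2.act_one intro!: exI[of _ "Hole {#}"])
  next
    fix x y u assume "x \<in> Obj D" "y \<in> Obj D" "u \<in> Arr D x y"
    then obtain p where "p \<in> VA" "u = cls x p y" "act F2 x (\<beta>V p) = y" by auto
    then show "ccomp D (ident D x) u = u" "ccomp D u (ident D y) = u"
      using derived_comp[of x "Hole {#}" p x y] derived_comp[of x p "Hole {#}" y y]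
        one\<beta>[of x] one\<beta>[of y] \<open>x \<in> Obj D\<close> \<open>y \<in> Obj D\<close>
      by (simp_all del: hom_simps)
  next
    fix x y c u assume "x \<in> Obj D" "y \<in> Obj D" "c \<in> HArr D x" "u \<in> Arr D x y"
    then obtain s p where *: "s \<in> HA" "p \<in> VA" "c = (\<alpha>H s, x)" "x = \<beta>H s"
      "u = cls x p y" "act F2 x (\<beta>V p) = y" by auto
    then show "cact D c u \<in> HArr D y"
      using derived_act[of s p x y] by (auto intro!: exI[of _ "plug s p"])
  next
    fix x y z c u v
    assume "x \<in> Obj D" "y \<in> Obj D" "z \<in> Obj D" "c \<in> HArr D x" "u \<in> Arr D x y" "v \<in> Arr D y z"
    then obtain s p q where *: "s \<in> HA" "p \<in> VA" "q \<in> VA" "c = (\<alpha>H s, x)" "x = \<beta>H s"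
      "u = cls x p y" "act F2 x (\<beta>V p) = y" "v = cls y q z" "act F2 y (\<beta>V q) = z" by auto
    have "cact D (cact D c u) v = cact D (\<alpha>H (plug s p), y) v"
      using derived_act[of s p x y] * by simp
    also have "\<dots> = (act F1 (\<alpha>H (plug s p)) (\<alpha>V q), z)"
      using * by (subst \<open>v = _\<close>, subst derived_act) auto
    also have "\<dots> = (act F1 (\<alpha>H s) (\<alpha>V (ctx_comp p q)), z)"
      using * by (simp add: F1.act_mult)
    also have "\<dots> = cact D (\<alpha>H s, x) (cls x (ctx_comp p q) z)"
      using * comp\<beta>[of x p q] \<open>x \<in> Obj D\<close>
      by (intro derived_act[symmetric]) (simp_all del: hom_simps)
    also have "\<dots> = cact D c (ccomp D u v)"
      using * derived_comp[of x p q y z] \<open>x \<in> Obj D\<close> by simp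
    finally show "cact D (cact D c u) v = cact D c (ccomp D u v)" .
  next
    fix x c assume "x \<in> Obj D" "c \<in> HArr D x"
    then obtain s where "s \<in> HA" "c = (\<alpha>H s, x)" "x = \<beta>H s" by auto
    then show "cact D c (ident D x) = c"
      using derived_act[of s "Hole {#}" x x] by (simp add: F1.act_one F2.act_one)
  next
    fix x y u u' assume xy: "x \<in> Obj D" "y \<in> Obj D" and "u \<in> Arr D x y" "u' \<in> Arr D x y"
      and eq: "\<And>c. c \<in> HArr D x \<Longrightarrow> cact D c u = cact D c u'"
    then obtain p q where *: "p \<in> VA" "q \<in> VA" "u = cls x p y" "u' = cls x q y"
      "act F2 x (\<beta>V p) = y" "act F2 x (\<beta>V q) = y" by auto
    have "\<alpha>H (plug s p) = \<alpha>H (plug s q)" if "s \<in> HA" "\<beta>H s = x" for s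
      using eq[of "(\<alpha>H s, x)"] * that derived_act[of s p x y] derived_act[of s q x y] by auto
    then show "u = u'" using * xy cls_eq_iff[of x p q y] by simp
  next
    fix x y z u c assume xyz: "x \<in> Obj D" "y \<in> Obj D" "z \<in> Obj D" "u \<in> Arr D x y" "c \<in> HArr D z"
    then obtain p s where *: "s \<in> HA" "p \<in> VA" "c = (\<alpha>H s, \<beta>H s)" "z = \<beta>H s"
      "u = cls x p y" "act F2 x (\<beta>V p) = y" by auto
    then show "cadd D u c \<in> Arr D x (y \<otimes>\<^bsub>objs D\<^esub> z)"
      using xyz derived_add[of x p y s] act_\<beta>V_add[of x p s]
      by (auto intro!: exI[of _ "ctx_add p s"])
  next
    fix x' x y z f u c
    assume xyz: "x' \<in> Obj D" "x \<in> Obj D" "y \<in> Obj D" "z \<in> Obj D" "f \<in> Arr D x' x"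
      "u \<in> Arr D x y" "c \<in> HArr D z"
    then obtain p q s where *: "s \<in> HA" "p \<in> VA" "q \<in> VA" "c = (\<alpha>H s, \<beta>H s)" "z = \<beta>H s"
      "f = cls x' q x" "act F2 x' (\<beta>V q) = x" "u = cls x p y" "act F2 x (\<beta>V p) = y" by auto
    have "cadd D u c = cls x (ctx_add p s) (hadd F2 y z)"
      "ccomp D f u = cls x' (ctx_comp q p) y"
      "act F2 x (\<beta>V (ctx_add p s)) = hadd F2 y z" "act F2 x' (\<beta>V (ctx_comp q p)) = y"
      using * xyz derived_add[of x p y s] derived_comp[of x' q p x y] act_\<beta>V_add[of x p s]
        comp\<beta>[of x' q p]
      by (simp_all del: hom_simps)
    then show "ccomp D f (cadd D u c) = cadd D (ccomp D f u) c"
      using * xyz derived_comp[of x' q "ctx_add p s" x "hadd F2 y z"]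
        derived_add[of x' "ctx_comp q p" y s] free_closed(2,3)
      by (simp add: ctx_add_comp del: hom_simps)
  next
    fix x y z z' u c d
    assume xyz: "x \<in> Obj D" "y \<in> Obj D" "z \<in> Obj D" "z' \<in> Obj D"
      "u \<in> Arr D x y" "c \<in> HArr D z" "d \<in> HArr D z'"
    then obtain p s t where *: "s \<in> HA" "t \<in> HA" "p \<in> VA" "c = (\<alpha>H s, \<beta>H s)" "z = \<beta>H s"
      "d = (\<alpha>H t, \<beta>H t)" "z' = \<beta>H t" "u = cls x p y" "act F2 x (\<beta>V p) = y" by auto
    have cd: "c \<otimes>\<^bsub>harrs D\<^esub> d = (\<alpha>H (s + t), \<beta>H (s + t))"
      using * by (simp add: DirProd_def)
    have "cadd D (cadd D u c) d = cls x (ctx_add p (s + t)) (hadd F2 y (\<beta>H (s + t)))"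
      using * xyz by (simp add: derived_add act_\<beta>V_add ctx_add_assoc H2.m_assoc)
    also have "\<dots> = cadd D u (c \<otimes>\<^bsub>harrs D\<^esub> d)"
      unfolding cd using * xyz by (simp add: derived_add del: hom_simps(9,10))
    finally show "cadd D (cadd D u c) d = cadd D u (c \<otimes>\<^bsub>harrs D\<^esub> d)" .
  qed
qed

end

end

theory Submission
  imports Defs
begin

text \<open>
  Both parts pass through the same intermediate notion, a cover of the free forest algebra by \<open>F\<close>:
  nonempty sets \<open>L s\<close> of elements of \<open>F\<close>, compatible with addition, such that each context, placed
  at each object \<open>x\<close>, is imitated by some element of \<open>V\<close>, and such that \<open>L s\<close> together with \<open>\<beta> s\<close>
  determines \<open>\<alpha> s\<close>.
  A cover yields a division of \<open>F1\<close> by the wreath product: take all \<open>(h, \<beta> s)\<close> with \<open>h \<in> L s\<close> and all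
  \<open>(f, \<beta> p)\<close> such that \<open>f x\<close> imitates \<open>p\<close> at every \<open>x\<close>; faithfulness of \<open>F1\<close> makes the vertical
  part of the homomorphism well defined.  It also yields a division of the derived category, by taking
  unions over representatives.
  Conversely a homomorphism \<open>\<delta>\<close> as in (b) gives the cover by singletons \<open>{fst (\<delta> s)}\<close>, and a
  division of the derived category gives a cover after adjoining \<open>0\<close> to the set covering the zero
  half-arrow.
\<close>

section \<open>Covers of the free forest algebra and lifts of contexts\<close>

text \<open>The witness \<open>v\<close> in \<open>L_lift_ex\<close> is chosen before
  \<open>s\<close>: one element serves all forests over \<open>x\<close>, because the first
  coordinate of a wreath product element sees only the object. \<open>L_zero\<close> provides the
  identity that a submonoid of the wreath product must contain.\<close>

locale forest_cover =
  derived_setup F1 F2 A \<alpha>H \<alpha>V \<beta>H \<beta>V + F: forest_algebra F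
  for F1 :: "('h1, 'v1) forest_alg" and F2 :: "('h2, 'v2) forest_alg"
    and A :: "'a set" and \<alpha>H \<alpha>V \<beta>H \<beta>V and F :: "('h, 'v) forest_alg" +
  fixes L :: "'a forest \<Rightarrow> 'h set"
  assumes L_subset: "s \<in> HA \<Longrightarrow> L s \<subseteq> H_of F"
    and L_nonempty: "s \<in> HA \<Longrightarrow> L s \<noteq> {}"
    and L_zero: "\<one>\<^bsub>hmon F\<^esub> \<in> L {#}"
    and L_add: "s \<in> HA \<Longrightarrow> t \<in> HA \<Longrightarrow> h \<in> L s \<Longrightarrow> g \<in> L t \<Longrightarrow> hadd F h g \<in> L (s + t)"
    and L_determines: "s \<in> HA \<Longrightarrow> t \<in> HA \<Longrightarrow> \<beta>H s = \<beta>H t \<Longrightarrow> h \<in> L s \<Longrightarrow> h \<in> L t \<Longrightarrow>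
      \<alpha>H s = \<alpha>H t"
    and L_lift_ex: "x \<in> H_of F2 \<Longrightarrow> p \<in> VA \<Longrightarrow>
      \<exists>v \<in> V_of F. \<forall>s \<in> HA. \<beta>H s = x \<longrightarrow> (\<forall>h \<in> L s. act F h v \<in> L (plug s p))"
begin

definition lift :: "'h2 \<Rightarrow> 'a ctx \<Rightarrow> 'v set" where
  "lift x p = {v \<in> V_of F. \<forall>s \<in> HA. \<beta>H s = x \<longrightarrow> (\<forall>h \<in> L s. act F h v \<in> L (plug s p))}"

lemma lift_nonempty: "x \<in> H_of F2 \<Longrightarrow> p \<in> VA \<Longrightarrow> lift x p \<noteq> {}"
  using L_lift_ex unfolding lift_def by blast

lemma lift_closed: "v \<in> lift x p \<Longrightarrow> v \<in> V_of F"
  unfolding lift_def by blast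

lemma act_lift: "v \<in> lift (\<beta>H s) p \<Longrightarrow> s \<in> HA \<Longrightarrow> h \<in> L s \<Longrightarrow> act F h v \<in> L (plug s p)"
  unfolding lift_def by blast

lemma lift_one: "\<one>\<^bsub>vmon F\<^esub> \<in> lift x (Hole {#})"
proof -
  interpret FV: monoid "vmon F" by (rule F.vmon_monoid)
  have "act F h \<one>\<^bsub>vmon F\<^esub> = h" if "s \<in> HA" "h \<in> L s" for s h
    using that L_subset by (intro F.act_one) blast
  then show ?thesis unfolding lift_def by simp
qed

text \<open>After \<open>p\<close> the current object is \<open>act F2 x (\<beta>V p)\<close>, so
  \<open>q\<close> has to be lifted there; this is the same shift of argument as in the wreath
  multiplication.\<close>

lemma lift_comp:
  assumes "p \<in> VA" and v: "v \<in> lift x p" and w: "w \<in> lift (act F2 x (\<beta>V p)) q"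
  shows "vmult F v w \<in> lift x (ctx_comp p q)"
proof -
  interpret FV: monoid "vmon F" by (rule F.vmon_monoid)
  have vw: "v \<in> V_of F" "w \<in> V_of F" using v w by (auto intro: lift_closed)
  have "act F h (vmult F v w) \<in> L (plug s (ctx_comp p q))"
    if s: "s \<in> HA" "\<beta>H s = x" "h \<in> L s" for s h
  proof -
    have "act F (act F h v) w \<in> L (plug (plug s p) q)"
      using s v w assms(1)
      by (intro act_lift) (simp_all add: hom_simps free_closed act_lift del: free_alg_simps(1,2))
    moreover have "h \<in> H_of F" using s L_subset by blast
    ultimately show ?thesis using vw by (simp add: F.act_mult plug_ctx_comp)
  qed
  then show ?thesis using vw unfolding lift_def by blast
qed

lemma lift_add:
  assumes "p \<in> VA" "s \<in> HA" and v: "v \<in> lift x p" and h: "h \<in> L s"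
  shows "vadd F v h \<in> lift x (ctx_add p s)"
proof -
  have vh: "v \<in> V_of F" "h \<in> H_of F" using v h assms(2) L_subset by (auto dest: lift_closed)
  have "act F g (vadd F v h) \<in> L (plug t (ctx_add p s))"
    if t: "t \<in> HA" "\<beta>H t = x" "g \<in> L t" for t g
  proof -
    have "hadd F (act F g v) h \<in> L (plug t p + s)"
      using t v h assms
      by (intro L_add) (simp_all add: free_closed act_lift del: free_alg_simps(1,2))
    moreover have "g \<in> H_of F" using t L_subset by blast
    ultimately show ?thesis using vh by (simp add: F.act_vadd plug_ctx_add)
  qed
  then show ?thesis using F.vadd_closed[OF vh] unfolding lift_def by blast
qed

text \<open>For any \<open>h\<close> in \<open>L s\<close>, the element \<open>act F h v\<close>
  lies in both \<open>L (plug s p)\<close> and \<open>L (plug s q)\<close>, and the two forests have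
  the same image under \<open>\<beta>H\<close>. This gives both the well-definedness of the vertical
  homomorphism and the disjointness of the sets covering parallel arrows.\<close>

lemma lift_determines_plug:
  assumes "p \<in> VA" "q \<in> VA" "s \<in> HA" "v \<in> lift (\<beta>H s) p" "v \<in> lift (\<beta>H s) q"
    and "act F2 (\<beta>H s) (\<beta>V p) = act F2 (\<beta>H s) (\<beta>V q)"
  shows "\<alpha>H (plug s p) = \<alpha>H (plug s q)"
proof -
  obtain h where "h \<in> L s" using L_nonempty assms(3) by blast
  then show ?thesis
    using assms
    by (intro L_determines[of _ _ "act F h v"])
      (simp_all add: hom_simps free_closed act_lift del: free_alg_simps(1,2))
qed

section \<open>From a cover to a division by the wreath product\<close>

lemma alg_divides_wreath: "alg_divides F1 (wreath F F2)"
proof -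
  interpret W: forest_algebra "wreath F F2"
    by (rule forest_algebra_wreath) (rule F.forest_algebra_axioms F2.forest_algebra_axioms)+
  interpret WH: comm_monoid "hmon (wreath F F2)" by (rule W.hmon_comm_monoid)
  interpret WV: monoid "vmon (wreath F F2)" by (rule W.vmon_monoid)
  interpret F1H: comm_monoid "hmon F1" by (rule F1.hmon_comm_monoid)
  note [simp del] = free_alg_simps(1,2)
  note [simp] = hom_simps free_closed
  define S where "S = {(h, \<beta>H s) | h s. s \<in> HA \<and> h \<in> L s}"
  define T where "T = {(f, \<beta>V p) | f p. f \<in> H_of F2 \<rightarrow>\<^sub>E V_of F \<and> p \<in> VA \<and>
    (\<forall>x \<in> H_of F2. f x \<in> lift x p)}"
  \<comment> \<open>The choices made by \<open>SOME\<close> are immaterial: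
    \<open>L_determines\<close> fixes the value of \<open>\<alpha>H\<close>, and faithfulness of
    \<open>F1\<close> that of \<open>\<alpha>V\<close>.\<close>
  define \<phi>H where "\<phi>H = (\<lambda>(h, x). \<alpha>H (SOME s. s \<in> HA \<and> \<beta>H s = x \<and> h \<in> L s))"
  define \<phi>V where "\<phi>V = (\<lambda>(f, w). \<alpha>V (SOME p. p \<in> VA \<and> \<beta>V p = w \<and>
    (\<forall>x \<in> H_of F2. f x \<in> lift x p)))"
  have \<phi>H: "\<phi>H (h, \<beta>H s) = \<alpha>H s" if "s \<in> HA" "h \<in> L s" for h s
  proof -
    have "\<exists>t. t \<in> HA \<and> \<beta>H t = \<beta>H s \<and> h \<in> L t" using that by blast
    from someI_ex[OF this] show ?thesis
      unfolding \<phi>H_def prod.case using that by (intro L_determines[of _ _ h]) auto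
  qed
  have \<phi>V: "\<phi>V (f, \<beta>V p) = \<alpha>V p" if p: "p \<in> VA" "\<forall>x \<in> H_of F2. f x \<in> lift x p" for f p
  proof -
    define q where "q = (SOME q. q \<in> VA \<and> \<beta>V q = \<beta>V p \<and> (\<forall>x \<in> H_of F2. f x \<in> lift x q))"
    have "\<exists>q. q \<in> VA \<and> \<beta>V q = \<beta>V p \<and> (\<forall>x \<in> H_of F2. f x \<in> lift x q)" using that by blast
    from someI_ex[OF this] have q: "q \<in> VA" "\<beta>V q = \<beta>V p" "\<forall>x \<in> H_of F2. f x \<in> lift x q"
      unfolding q_def by blast+
    have "\<alpha>V q = \<alpha>V p"
    \<comment> \<open>As \<open>\<alpha>H\<close> is onto, it is enough to compare the actions on
      elements \<open>\<alpha>H s\<close>; there \<open>f (\<beta>H s)\<close> is a common lift of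
      \<open>p\<close> and \<open>q\<close>.\<close>
    proof (rule F1.faithful)
      fix h assume "h \<in> H_of F1"
      then obtain s where s: "s \<in> HA" "h = \<alpha>H s"
        using \<alpha> unfolding forest_surj_hom_def by blast
      then have "\<alpha>H (plug s q) = \<alpha>H (plug s p)"
        using p q by (intro lift_determines_plug[of _ _ _ "f (\<beta>H s)"]) auto
      then show "act F1 h (\<alpha>V q) = act F1 h (\<alpha>V p)" using s p q by simp
    qed (use p q in auto)
    then show ?thesis unfolding \<phi>V_def q_def by simp
  qed
  have S_ok: "x \<in> H_of (wreath F F2)" if "x \<in> S" for x
    using that L_subset unfolding S_def by auto
  have T_ok: "x \<in> V_of (wreath F F2)" if "x \<in> T" for x
    using that unfolding T_def by auto
  have SI: "(h, \<beta>H s) \<in> S" if "s \<in> HA" "h \<in> L s" for h s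
    using that unfolding S_def by blast
  have TI: "(f, \<beta>V p) \<in> T"
    if "f \<in> H_of F2 \<rightarrow>\<^sub>E V_of F" "p \<in> VA" "\<forall>x \<in> H_of F2. f x \<in> lift x p" for f p
    using that unfolding T_def by blast
  have add: "hadd (wreath F F2) x y \<in> S \<and> \<phi>H (hadd (wreath F F2) x y) = hadd F1 (\<phi>H x) (\<phi>H y)"
    if "x \<in> S" "y \<in> S" for x y
  proof -
    obtain h s g t where *: "x = (h, \<beta>H s)" "y = (g, \<beta>H t)" "s \<in> HA" "t \<in> HA" "h \<in> L s" "g \<in> L t"
      using \<open>x \<in> S\<close> \<open>y \<in> S\<close> unfolding S_def by blast
    then have "hadd (wreath F F2) x y = (hadd F h g, \<beta>H (s + t))" by simp
    then show ?thesis
      using * SI[of "s + t" "hadd F h g"] \<phi>H[of "s + t" "hadd F h g"] L_add[of s t h g]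
      by (simp add: \<phi>H)
  qed
  have zero: "\<one>\<^bsub>hmon (wreath F F2)\<^esub> \<in> S \<and> \<phi>H \<one>\<^bsub>hmon (wreath F F2)\<^esub> = \<one>\<^bsub>hmon F1\<^esub>"
    using SI[of "{#}", OF _ L_zero] \<phi>H[of "{#}", OF _ L_zero] by (simp add: DirProd_def)
  have mul: "vmult (wreath F F2) x y \<in> T \<and> \<phi>V (vmult (wreath F F2) x y) = vmult F1 (\<phi>V x) (\<phi>V y)"
    if "x \<in> T" "y \<in> T" for x y
  proof -
    obtain f p g q where *: "x = (f, \<beta>V p)" "y = (g, \<beta>V q)" "p \<in> VA" "q \<in> VA"
      "\<forall>k \<in> H_of F2. f k \<in> lift k p" "\<forall>k \<in> H_of F2. g k \<in> lift k q"
      using \<open>x \<in> T\<close> \<open>y \<in> T\<close> unfolding T_def by blast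
    define e where "e = (\<lambda>k \<in> H_of F2. vmult F (f k) (g (act F2 k (\<beta>V p))))"
    have e: "vmult (wreath F F2) x y = (e, \<beta>V (ctx_comp p q))" using * by (simp add: e_def)
    have el: "\<forall>k \<in> H_of F2. e k \<in> lift k (ctx_comp p q)"
      unfolding e_def using * by (auto intro!: lift_comp F2.act_closed)
    have "e \<in> H_of F2 \<rightarrow>\<^sub>E V_of F"
      using el by (auto simp: e_def intro: lift_closed)
    then show ?thesis
      using * el e TI[of e "ctx_comp p q"] \<phi>V[of "ctx_comp p q" e] by (simp add: \<phi>V)
  qed
  have one: "\<one>\<^bsub>vmon (wreath F F2)\<^esub> \<in> T \<and> \<phi>V \<one>\<^bsub>vmon (wreath F F2)\<^esub> = \<one>\<^bsub>vmon F1\<^esub>"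
    using TI[of "\<lambda>k \<in> H_of F2. \<one>\<^bsub>vmon F\<^esub>" "Hole {#}"] \<phi>V[of "Hole {#}" "\<lambda>k \<in> H_of F2. \<one>\<^bsub>vmon F\<^esub>"]
    by (simp add: lift_one lift_closed[OF lift_one])
  have ac: "act (wreath F F2) x y \<in> S \<and> \<phi>H (act (wreath F F2) x y) = act F1 (\<phi>H x) (\<phi>V y)"
    if "x \<in> S" "y \<in> T" for x y
  proof -
    obtain h s f p where *: "x = (h, \<beta>H s)" "s \<in> HA" "h \<in> L s"
      "y = (f, \<beta>V p)" "p \<in> VA" "\<forall>k \<in> H_of F2. f k \<in> lift k p"
      using \<open>x \<in> S\<close> \<open>y \<in> T\<close> unfolding S_def T_def by blast
    have m: "act F h (f (\<beta>H s)) \<in> L (plug s p)" using * by (intro act_lift) auto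
    have "act (wreath F F2) x y = (act F h (f (\<beta>H s)), \<beta>H (plug s p))" using * by simp
    then show ?thesis
      using * m SI[OF _ m] \<phi>H[OF _ m] by (simp add: \<phi>H \<phi>V)
  qed
  have va: "vadd (wreath F F2) y x \<in> T" if "x \<in> S" "y \<in> T" for x y
  proof -
    obtain h s f p where *: "x = (h, \<beta>H s)" "s \<in> HA" "h \<in> L s"
      "y = (f, \<beta>V p)" "p \<in> VA" "f \<in> H_of F2 \<rightarrow>\<^sub>E V_of F" "\<forall>k \<in> H_of F2. f k \<in> lift k p"
      using \<open>x \<in> S\<close> \<open>y \<in> T\<close> unfolding S_def T_def by blast
    define e where "e = (\<lambda>k \<in> H_of F2. vadd F (f k) h)"
    have hF: "h \<in> H_of F" using * L_subset by blast
    have el: "\<forall>k \<in> H_of F2. e k \<in> lift k (ctx_add p s)"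
      unfolding e_def using * by (auto intro!: lift_add)
    then have eT: "(e, \<beta>V (ctx_add p s)) \<in> T"
      using * by (intro TI) (auto simp: e_def intro: lift_closed)
    \<comment> \<open>\<open>vadd\<close> is a definite description, so the candidate is identified
      through its action; \<open>act_\<beta>V_add\<close> handles the second coordinate.\<close>
    have "vadd (wreath F F2) y x = (e, \<beta>V (ctx_add p s))"
    proof (rule W.vadd_unique)
      fix g assume "g \<in> H_of (wreath F F2)"
      then show "act (wreath F F2) g (e, \<beta>V (ctx_add p s)) =
          hadd (wreath F F2) (act (wreath F F2) g y) x"
        using * hF by (cases g) (auto simp: e_def act_\<beta>V_add F.act_vadd PiE_app)
    qed (use \<open>x \<in> S\<close> \<open>y \<in> T\<close> eT S_ok T_ok in blast)+
    then show ?thesis using eT by simp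
  qed
  have "subalgebra S T (wreath F F2)"
    unfolding subalgebra_def
    using S_ok T_ok add zero mul one ac va
    by (auto intro!: submonoid.intro simp del: wreath_simps)
  moreover have "\<phi>H ` S = H_of F1"
  proof (intro equalityI subsetI)
    fix h assume "h \<in> H_of F1"
    then obtain s where s: "s \<in> HA" "h = \<alpha>H s"
      using \<alpha> unfolding forest_surj_hom_def by blast
    obtain k where "k \<in> L s" using L_nonempty s by blast
    then show "h \<in> \<phi>H ` S" using s \<phi>H SI by (metis image_eqI)
  qed (auto simp: S_def \<phi>H)
  moreover have "\<phi>V ` T = V_of F1"
  proof (intro equalityI subsetI)
    fix v assume "v \<in> V_of F1"
    then obtain p where p: "p \<in> VA" "v = \<alpha>V p"
      using \<alpha> unfolding forest_surj_hom_def by blast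
    \<comment> \<open>Lifts of \<open>p\<close> may be chosen independently at the different
      objects, since membership in \<open>T\<close> imposes no relation between the values of
      \<open>f\<close>.\<close>
    define f where "f = (\<lambda>x \<in> H_of F2. SOME v. v \<in> lift x p)"
    have f: "\<forall>x \<in> H_of F2. f x \<in> lift x p"
      unfolding f_def using lift_nonempty p by (auto simp: some_in_eq)
    then have "(f, \<beta>V p) \<in> T"
      using p by (intro TI) (auto simp: f_def intro: lift_closed)
    then show "v \<in> \<phi>V ` T" using p f \<phi>V by (metis image_eqI)
  qed (auto simp: T_def \<phi>V)
  ultimately have "subalgebra S T (wreath F F2) \<and>
      forest_surj_hom (restrict_alg (wreath F F2) S T) F1 \<phi>H \<phi>V"
    using add zero mul one ac
    unfolding forest_surj_hom_def forest_hom_def monoid_hom_def hom_def restrict_alg_def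
    by (auto simp del: wreath_simps)
  then show ?thesis unfolding alg_divides_def by blast
qed

section \<open>From a cover to a division of the derived category\<close>

lemma cat_divides_derived: "cat_divides D F"
proof -
  note [simp del] = free_alg_simps(1,2)
  note [simp] = hom_simps free_closed
  define KH where "KH = (\<lambda>c. \<Union> (L ` {s \<in> HA. (\<alpha>H s, \<beta>H s) = c}))"
  define KV :: "('h2 \<times> 'a ctx \<times> 'h2) set \<Rightarrow> 'v set"
    where "KV = (\<lambda>u. \<Union>(x, p, y) \<in> u. lift x p)"
  have KHI: "h \<in> KH (\<alpha>H s, \<beta>H s)" if "s \<in> HA" "h \<in> L s" for h s
    using that unfolding KH_def by auto
  have KHE: "\<exists>s \<in> HA. c = (\<alpha>H s, \<beta>H s) \<and> \<beta>H s = x \<and> h \<in> L s"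
    if "c \<in> HArr D x" "h \<in> KH c" for c x h
    using that unfolding KH_def by (auto; metis)
  have KVI: "v \<in> KV (cls x p (act F2 x (\<beta>V p)))" if "x \<in> H_of F2" "p \<in> VA" "v \<in> lift x p" for v x p
    using that cls_refl[of x p] unfolding KV_def by blast
  \<comment> \<open>A lift in \<open>KV u\<close> may come from any triple in \<open>u\<close>, but
    that triple again has class \<open>u\<close>, so its context can serve as the
    representative.\<close>
  have KVE: "\<exists>p \<in> VA. u = cls x p y \<and> act F2 x (\<beta>V p) = y \<and> v \<in> lift x p"
    if "x \<in> H_of F2" "u \<in> Arr D x y" "v \<in> KV u" for u x y v
  proof -
    from \<open>u \<in> Arr D x y\<close> obtain p where p: "p \<in> VA" "act F2 x (\<beta>V p) = y" "u = cls x p y"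
      unfolding derived_Arr by blast
    from \<open>v \<in> KV u\<close> obtain x' q y' where q: "(x', q, y') \<in> u" "v \<in> lift x' q"
      unfolding KV_def by blast
    then have "(x', q, y') \<in> cls x p y" using p by simp
    then have "q \<in> VA" "x' = x" "act F2 x (\<beta>V q) = y" "cls x q y = u"
      unfolding mem_cls[OF \<open>x \<in> H_of F2\<close> p(1,2)] using p by auto
    then show ?thesis using q by blast
  qed
  show ?thesis
    unfolding cat_divides_def
  proof (intro exI[of _ KH] exI[of _ KV] conjI ballI impI)
    fix x c assume "x \<in> Obj D" "c \<in> HArr D x"
    then show "KH c \<subseteq> H_of F" "KH c \<noteq> {}"
      using L_subset L_nonempty unfolding KH_def by auto
  next
    fix x y u assume *: "x \<in> Obj D" "y \<in> Obj D" "u \<in> Arr D x y"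
    show "KV u \<subseteq> V_of F"
      unfolding KV_def by (auto dest: lift_closed)
    show "KV u \<noteq> {}" using * KVI lift_nonempty unfolding derived_Arr by fastforce
  next
    fix x y z u v k l
    assume *: "x \<in> Obj D" "y \<in> Obj D" "z \<in> Obj D" "u \<in> Arr D x y" "v \<in> Arr D y z"
      "k \<in> KV u" "l \<in> KV v"
    obtain p where p: "p \<in> VA" "u = cls x p y" "act F2 x (\<beta>V p) = y" "k \<in> lift x p"
      using KVE[of x u y k] * by auto
    obtain q where q: "q \<in> VA" "v = cls y q z" "act F2 y (\<beta>V q) = z" "l \<in> lift y q"
      using KVE[of y v z l] * by auto
    show "vmult F k l \<in> KV (ccomp D u v)"
      using * p q KVI[of x "ctx_comp p q" "vmult F k l"] derived_comp[of x p q y z]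
        lift_comp[of p k x l q]
      by (simp flip: F2.act_mult)
  next
    fix x y c u k l
    assume *: "x \<in> Obj D" "y \<in> Obj D" "c \<in> HArr D x" "u \<in> Arr D x y" "k \<in> KH c" "l \<in> KV u"
    obtain s where s: "s \<in> HA" "c = (\<alpha>H s, \<beta>H s)" "\<beta>H s = x" "k \<in> L s" using KHE[of c x k] * by auto
    obtain p where p: "p \<in> VA" "u = cls x p y" "act F2 x (\<beta>V p) = y" "l \<in> lift x p"
      using KVE[of x u y l] * by auto
    show "act F k l \<in> KH (cact D c u)"
      using s p KHI[of "plug s p" "act F k l"] derived_act[of s p x y] act_lift[of l s p k] by simp
  next
    fix x y c d k l
    assume *: "x \<in> Obj D" "y \<in> Obj D" "c \<in> HArr D x" "d \<in> HArr D y" "k \<in> KH c" "l \<in> KH d"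
    obtain s where s: "s \<in> HA" "c = (\<alpha>H s, \<beta>H s)" "k \<in> L s" using KHE[of c x k] * by auto
    obtain t where t: "t \<in> HA" "d = (\<alpha>H t, \<beta>H t)" "l \<in> L t" using KHE[of d y l] * by auto
    show "hadd F k l \<in> KH (c \<otimes>\<^bsub>harrs D\<^esub> d)"
      using s t KHI[of "s + t" "hadd F k l"] L_add[of s t k l] by (simp add: DirProd_def)
  next
    fix x y z u c k l
    assume *: "x \<in> Obj D" "y \<in> Obj D" "z \<in> Obj D" "u \<in> Arr D x y" "c \<in> HArr D z"
      "k \<in> KV u" "l \<in> KH c"
    obtain s where s: "s \<in> HA" "c = (\<alpha>H s, \<beta>H s)" "l \<in> L s" using KHE[of c z l] * by auto
    obtain p where p: "p \<in> VA" "u = cls x p y" "act F2 x (\<beta>V p) = y" "k \<in> lift x p"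
      using KVE[of x u y k] * by auto
    show "vadd F k l \<in> KV (cadd D u c)"
      using * s p KVI[of x "ctx_add p s" "vadd F k l"] derived_add[of x p y s]
        lift_add[of p s k x l]
      by (simp add: act_\<beta>V_add)
  next
    fix x y u u'
    assume *: "x \<in> Obj D" "y \<in> Obj D" "u \<in> Arr D x y" "u' \<in> Arr D x y" "u \<noteq> u'"
    show "KV u \<inter> KV u' = {}"
    proof (rule ccontr)
      assume "KV u \<inter> KV u' \<noteq> {}"
      then obtain v where v: "v \<in> KV u" "v \<in> KV u'" by blast
      obtain p where p: "p \<in> VA" "u = cls x p y" "act F2 x (\<beta>V p) = y" "v \<in> lift x p"
        using KVE[of x u y v] * v by auto
      obtain q where q: "q \<in> VA" "u' = cls x q y" "act F2 x (\<beta>V q) = y" "v \<in> lift x q"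
        using KVE[of x u' y v] * v by auto
      \<comment> \<open>A common element \<open>v\<close> lifts both \<open>p\<close> and
        \<open>q\<close> at \<open>x\<close>, so the two contexts act alike under
        \<open>\<alpha>H\<close> on all forests over \<open>x\<close>, which is the relation
        defining arrows.\<close>
      have "\<forall>s \<in> HA. \<beta>H s = x \<longrightarrow> \<alpha>H (plug s p) = \<alpha>H (plug s q)"
        using lift_determines_plug[OF p(1) q(1), of _ v] p q by simp
      then show False using * p q cls_eq_iff[of x p q y] by simp
    qed
  next
    fix y c c' assume "y \<in> Obj D" "c \<in> HArr D y" "c' \<in> HArr D y" "c \<noteq> c'"
    then show "KH c \<inter> KH c' = {}"
      using KHE[of c y] KHE[of c' y] L_determines by (metis disjoint_iff)
  qed
qed

end

section \<open>Covers from wreath product homomorphisms and from category divisions\<close>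

context derived_setup
begin

text \<open>The first coordinate of \<open>\<delta>H s\<close> together with
  \<open>\<beta>H s\<close>, its second coordinate, recovers \<open>\<delta>H s\<close>, and hence
  \<open>\<alpha>H s\<close> through \<open>\<gamma>H\<close>.\<close>

lemma forest_cover_if_wreath_hom:
  fixes F :: "('c, 'd) forest_alg"
  assumes F: "forest_algebra F"
    and \<delta>: "forest_hom (free_alg A) (wreath F F2) \<delta>H \<delta>V"
    and \<alpha>\<gamma>: "\<And>s. s \<in> HA \<Longrightarrow> \<alpha>H s = \<gamma>H (\<delta>H s)"
    and \<beta>H: "\<And>s. s \<in> HA \<Longrightarrow> \<beta>H s = snd (\<delta>H s)"
  shows "forest_cover F1 F2 A \<alpha>H \<alpha>V \<beta>H \<beta>V F (\<lambda>s. {fst (\<delta>H s)})"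
proof -
  interpret F: forest_algebra F by (rule F)
  note [simp del] = free_alg_simps(1,2)
  note [simp] = free_closed
  have \<delta>_closed: "\<delta>H s \<in> H_of F \<times> H_of F2" if "s \<in> HA" for s
    using \<delta> that unfolding forest_hom_def monoid_hom_def hom_def by auto
  have \<delta>V_closed: "\<delta>V p \<in> (H_of F2 \<rightarrow>\<^sub>E V_of F) \<times> V_of F2" if "p \<in> VA" for p
    using \<delta> that unfolding forest_hom_def monoid_hom_def hom_def by auto
  have \<delta>_zero: "\<delta>H {#} = (\<one>\<^bsub>hmon F\<^esub>, \<one>\<^bsub>hmon F2\<^esub>)"
    using \<delta> unfolding forest_hom_def monoid_hom_def by simp
  have \<delta>_add: "\<delta>H (s + t) = hadd (wreath F F2) (\<delta>H s) (\<delta>H t)" if "s \<in> HA" "t \<in> HA" for s t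
    using \<delta> that unfolding forest_hom_def monoid_hom_def hom_def by simp
  have \<delta>_act: "\<delta>H (plug s p) = act (wreath F F2) (\<delta>H s) (\<delta>V p)" if "s \<in> HA" "p \<in> VA" for s p
    using \<delta> that unfolding forest_hom_def by simp
  show ?thesis
  proof (unfold_locales, goal_cases)
    case (1 s) then show ?case using \<delta>_closed[of s] by auto
  next
    case 3 show ?case by (simp add: \<delta>_zero)
  next
    case (4 s t h g)
    then show ?case by (simp add: \<delta>_add mult_DirProd')
  next
    case (5 s t h)
    then have "\<delta>H s = \<delta>H t" using \<beta>H by (simp add: prod_eq_iff)
    then show ?case using 5 \<alpha>\<gamma> by simp
  next
    case (6 x p)
    \<comment> \<open>On every forest over \<open>x\<close> the wreath action evaluates the first
      coordinate of \<open>\<delta>V p\<close> at \<open>x\<close>, so \<open>f x\<close> is a lift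
      that does not depend on the forest.\<close>
    then obtain f w where fw: "\<delta>V p = (f, w)" "f x \<in> V_of F" using \<delta>V_closed[of p] by auto
    have "fst (\<delta>H (plug s p)) = act F (fst (\<delta>H s)) (f x)" if "s \<in> HA" "\<beta>H s = x" for s
      using that fw 6 \<beta>H[of s] by (cases "\<delta>H s") (simp add: \<delta>_act)
    then show ?case using fw by (intro bexI[of _ "f x"]) auto
  qed auto
qed

text \<open>The sets \<open>K s\<close> covering the half-arrow of \<open>s\<close> satisfy every
  condition on a cover except possibly \<open>L_zero\<close>, as a category division does not force
  the identity of \<open>F\<close> into the set covering the zero half-arrow. Adjoining it is
  harmless: translation by a fixed \<open>k0\<close> in \<open>K {#}\<close> maps the enlarged sets
  back into the old ones.\<close>

lemma forest_cover_if_cat_divides: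
  fixes F :: "('c, 'd) forest_alg"
  assumes F: "forest_algebra F" and div: "cat_divides D F"
  shows "\<exists>L. forest_cover F1 F2 A \<alpha>H \<alpha>V \<beta>H \<beta>V F L"
proof -
  interpret F: forest_algebra F by (rule F)
  interpret FH: comm_monoid "hmon F" by (rule F.hmon_comm_monoid)
  interpret FV: monoid "vmon F" by (rule F.vmon_monoid)
  interpret F1H: comm_monoid "hmon F1" by (rule F1.hmon_comm_monoid)
  interpret F2H: comm_monoid "hmon F2" by (rule F2.hmon_comm_monoid)
  note [simp del] = free_alg_simps(1,2)
  note [simp] = hom_simps free_closed
  obtain KH :: "'h \<times> 'k \<Rightarrow> 'c set" and KV :: "('k \<times> 'a ctx \<times> 'k) set \<Rightarrow> 'd set"
    where KH: "\<forall>x \<in> Obj D. \<forall>c \<in> HArr D x. KH c \<subseteq> H_of F \<and> KH c \<noteq> {}"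
    and KV: "\<forall>x \<in> Obj D. \<forall>y \<in> Obj D. \<forall>u \<in> Arr D x y. KV u \<subseteq> V_of F \<and> KV u \<noteq> {}"
    and KHV: "\<forall>x \<in> Obj D. \<forall>y \<in> Obj D. \<forall>c \<in> HArr D x. \<forall>u \<in> Arr D x y.
        \<forall>k \<in> KH c. \<forall>l \<in> KV u. act F k l \<in> KH (cact D c u)"
    and KHH: "\<forall>x \<in> Obj D. \<forall>y \<in> Obj D. \<forall>c \<in> HArr D x. \<forall>d \<in> HArr D y.
        \<forall>k \<in> KH c. \<forall>l \<in> KH d. hadd F k l \<in> KH (c \<otimes>\<^bsub>harrs D\<^esub> d)"
    and disj: "\<forall>y \<in> Obj D. \<forall>c \<in> HArr D y. \<forall>c' \<in> HArr D y. c \<noteq> c' \<longrightarrow> KH c \<inter> KH c' = {}"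
    using div unfolding cat_divides_def by (elim exE conjE) (rule that)
  have HArrI: "(\<alpha>H s, \<beta>H s) \<in> HArr D (\<beta>H s)" if "s \<in> HA" for s
    using that by auto
  define K where "K s = KH (\<alpha>H s, \<beta>H s)" for s
  have K: "K s \<subseteq> H_of F" "K s \<noteq> {}" if "s \<in> HA" for s
    using KH[rule_format, of "\<beta>H s", OF _ HArrI[OF that]] that unfolding K_def by auto
  have K_add: "hadd F k l \<in> K (s + t)" if "s \<in> HA" "t \<in> HA" "k \<in> K s" "l \<in> K t" for s t k l
    using KHH[rule_format, OF _ _ HArrI[OF that(1)] HArrI[OF that(2)], of k l] that
    unfolding K_def by (simp add: DirProd_def)
  have K_disj: "\<alpha>H s = \<alpha>H t" if "s \<in> HA" "t \<in> HA" "\<beta>H s = \<beta>H t" "k \<in> K s" "k \<in> K t" for s t k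
  proof (rule ccontr)
    assume "\<alpha>H s \<noteq> \<alpha>H t"
    moreover have "(\<alpha>H t, \<beta>H t) \<in> HArr D (\<beta>H s)" using that by auto
    ultimately have "K s \<inter> K t = {}"
      using disj[rule_format, of "\<beta>H s", OF _ HArrI] that unfolding K_def by simp
    then show False using that by blast
  qed
  obtain k0 where k0: "k0 \<in> K {#}" using K(2)[of "{#}"] by auto
  have k0F: "k0 \<in> H_of F" using K(1)[of "{#}"] k0 by auto
  \<comment> \<open>The identity is adjoined for every forest whose half-arrow is zero, so
    \<open>L s\<close>, like \<open>K s\<close>, depends on the half-arrow alone.\<close>
  define L where "L s = K s \<union> {h. h = \<one>\<^bsub>hmon F\<^esub> \<and> \<alpha>H s = \<one>\<^bsub>hmon F1\<^esub> \<and> \<beta>H s = \<one>\<^bsub>hmon F2\<^esub>}" for s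
  have KHeq: "K s = K t" if "\<alpha>H s = \<alpha>H t" "\<beta>H s = \<beta>H t" for s t
    using that unfolding K_def by simp
  \<comment> \<open>Adding \<open>{#}\<close> does not change the half-arrow, and the adjoined
    identity is sent to \<open>k0\<close> itself.\<close>
  have shift: "hadd F h k0 \<in> K s" if "s \<in> HA" "h \<in> L s" for s h
  proof (cases "h \<in> K s")
    case True then show ?thesis using K_add[of s "{#}" h k0] k0 that by simp
  next
    case False
    then show ?thesis using that k0 k0F KHeq[of s "{#}"] by (simp add: L_def)
  qed
  have L_F: "L s \<subseteq> H_of F" if "s \<in> HA" for s using K(1)[OF that] by (auto simp: L_def)
  show ?thesis
  proof (intro exI[of _ L], unfold_locales, goal_cases)
    case (1 s) then show ?case by (rule L_F)
  next
    case (2 s) then show ?case using K(2) by (auto simp: L_def)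
  next
    case 3 show ?case by (simp add: L_def)
  next
    case (4 s t h g)
    have "h \<in> H_of F" "g \<in> H_of F" using 4 L_F by auto
    \<comment> \<open>If one summand is the adjoined identity, the sum is the other summand, and
      \<open>s + t\<close> has the half-arrow of the corresponding forest.\<close>
    then show ?case
      using 4 K_add[of s t h g] KHeq[of "s + t" s] KHeq[of "s + t" t] by (auto simp: L_def)
  next
    case (5 s t h)
    \<comment> \<open>\<open>L s\<close> and \<open>L t\<close> may share the adjoined \<open>0\<close>; translation by \<open>k0\<close> moves it into \<open>K\<close>.\<close>
    then show ?case using shift K_disj by metis
  next
    case (6 x p)
    define y where "y = act F2 x (\<beta>V p)"
    have y: "y \<in> H_of F2" unfolding y_def using 6 by (simp add: F2.act_closed)
    \<comment> \<open>This arrow depends only on \<open>x\<close> and \<open>p\<close>, so an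
      element of its covering set imitates \<open>p\<close> on \<open>K s\<close> for all
      \<open>s\<close> over \<open>x\<close> at once.\<close>
    have u: "cls x p y \<in> Arr D x y" using 6 unfolding derived_Arr y_def by blast
    then obtain v where v: "v \<in> KV (cls x p y)" "v \<in> V_of F"
      using KV 6 y by (metis derived_simps(1) ex_in_conv subsetD)
    \<comment> \<open>\<open>v\<close> is only known to imitate \<open>p\<close> on
      \<open>K s\<close>. Adding \<open>k0\<close> first moves all of \<open>L s\<close>, including
      the adjoined identity, into \<open>K s\<close>.\<close>
    define w where "w = vmult F (vadd F \<one>\<^bsub>vmon F\<^esub> k0) v"
    have "act F h w \<in> L (plug s p)" if s: "s \<in> HA" "\<beta>H s = x" "h \<in> L s" for s h
    proof -
      have h: "h \<in> H_of F" using s L_F by blast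
      then have "act F h w = act F (hadd F h k0) v"
        using v k0F by (simp add: w_def F.vadd_closed F.act_vadd F.act_one flip: F.act_mult)
      moreover have "act F (hadd F h k0) v \<in> KH (cact D (\<alpha>H s, \<beta>H s) (cls x p y))"
        using KHV[rule_format, of x y, OF _ _ _ u] s v y 6 shift[of s h] HArrI[of s]
        unfolding K_def by simp
      ultimately show ?thesis
        using derived_act[of s p x y] s 6 by (simp add: L_def K_def y_def)
    qed
    moreover have "w \<in> V_of F" unfolding w_def using v k0F by (simp add: F.vadd_closed)
    ultimately show ?case by blast
  qed
qed

end

section \<open>Both implications by passing through a cover\<close>

theorem theorem1:
  fixes A :: "'a set"
    and F1 :: "('h1, 'v1) forest_alg"
    and F2 :: "('h2, 'v2) forest_alg"
    and F :: "('h, 'v) forest_alg"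
    and \<alpha>H :: "'a forest \<Rightarrow> 'h1" and \<alpha>V :: "'a ctx \<Rightarrow> 'v1"
    and \<beta>H :: "'a forest \<Rightarrow> 'h2" and \<beta>V :: "'a ctx \<Rightarrow> 'v2"
  assumes "finite A"
    and "finite_forest_algebra F1"
    and "finite_forest_algebra F2"
    and "forest_surj_hom (free_alg A) F1 \<alpha>H \<alpha>V"
    and "forest_surj_hom (free_alg A) F2 \<beta>H \<beta>V"
    and "finite_forest_algebra F"
  shows "(cat_divides (derived_category A F1 F2 \<alpha>H \<alpha>V \<beta>H \<beta>V) F \<longrightarrow>
            alg_divides F1 (wreath F F2)) \<and>
         (\<forall>(\<delta>H :: 'a forest \<Rightarrow> 'h \<times> 'h2) (\<delta>V :: 'a ctx \<Rightarrow> ('h2 \<Rightarrow> 'v) \<times> 'v2)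
            (\<gamma>H :: 'h \<times> 'h2 \<Rightarrow> 'h1) (\<gamma>V :: ('h2 \<Rightarrow> 'v) \<times> 'v2 \<Rightarrow> 'v1).
            forest_hom (free_alg A) (wreath F F2) \<delta>H \<delta>V \<longrightarrow>
            forest_hom (image_alg (free_alg A) (wreath F F2) \<delta>H \<delta>V) F1 \<gamma>H \<gamma>V \<longrightarrow>
            (\<forall>s \<in> H_of (free_alg A). \<alpha>H s = \<gamma>H (\<delta>H s)) \<longrightarrow>
            (\<forall>p \<in> V_of (free_alg A). \<alpha>V p = \<gamma>V (\<delta>V p)) \<longrightarrow>
            (\<forall>s \<in> H_of (free_alg A). \<beta>H s = snd (\<delta>H s)) \<longrightarrow>
            (\<forall>p \<in> V_of (free_alg A). \<beta>V p = snd (\<delta>V p)) \<longrightarrow>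
            cat_divides (derived_category A F1 F2 \<alpha>H \<alpha>V \<beta>H \<beta>V) F)"
proof -
  interpret F1: finite_forest_algebra F1 by fact
  interpret F2: finite_forest_algebra F2 by fact
  interpret F: finite_forest_algebra F by fact
  interpret derived_setup F1 F2 A \<alpha>H \<alpha>V \<beta>H \<beta>V by unfold_locales fact+
  show ?thesis
  proof (intro conjI impI allI)
    assume "cat_divides D F"
    then obtain L where "forest_cover F1 F2 A \<alpha>H \<alpha>V \<beta>H \<beta>V F L"
      using forest_cover_if_cat_divides[OF F.forest_algebra_axioms] by blast
    then show "alg_divides F1 (wreath F F2)"
      by (rule forest_cover.alg_divides_wreath)
  next
    fix \<delta>H \<delta>V \<gamma>H \<gamma>V
    assume "forest_hom (free_alg A) (wreath F F2) \<delta>H \<delta>V"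
      and "\<forall>s \<in> HA. \<alpha>H s = \<gamma>H (\<delta>H s)" and "\<forall>s \<in> HA. \<beta>H s = snd (\<delta>H s)"
    then have "forest_cover F1 F2 A \<alpha>H \<alpha>V \<beta>H \<beta>V F (\<lambda>s. {fst (\<delta>H s)})"
      by (intro forest_cover_if_wreath_hom[OF F.forest_algebra_axioms, where \<gamma>H = \<gamma>H]) blast+
    then show "cat_divides D F"
      by (rule forest_cover.cat_divides_derived)
  qed
qed

end
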